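(* There exists $n_0$ such that for every integer $n\ge n_0$ and every positive integer $b\le\left(1-\frac{30}{\ln^{1/4}n}\right)\frac{n}{\ln n}$, Maker has a strategy to win the $(1:b)$ Maker-Breaker Hamiltonicity game played on the edge set of the complete graph $K_n$ within at most $14n$ of his moves.
   Context: In the $(1:b)$ Maker-Breaker game on the edge set of $K_n$, two players, Maker and Breaker, alternately claim previously unclaimed edges of $K_n$; Breaker moves first and claims $b$ edges per turn, Maker claims $1$ edge per turn (if fewer edges remain than a player should claim, he claims all remaining ones). In the Hamiltonicity game, Maker wins if the graph on the vertex set of $K_n$ formed by his claimed edges contains a Hamilton cycle; Breaker wins otherwise. *)

theory Defs
  imports Complex_Main
begin

definition Kn_edges :: "nat \<Rightarrow> nat set set" where
  "Kn_edges n = {e. \<exists>u v. u < n \<and> v < n \<and> u \<noteq> v \<and> e = {u, v}}"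

definition free_edges :: "nat \<Rightarrow> nat set set \<Rightarrow> nat set set \<Rightarrow> nat set set" where
  "free_edges n M B = Kn_edges n - M - B"

definition breaker_moves :: "nat \<Rightarrow> nat \<Rightarrow> nat set set \<Rightarrow> nat set set \<Rightarrow> nat set set set" where
  "breaker_moves n b M B =
     {S. S \<subseteq> free_edges n M B \<and> card S = min b (card (free_edges n M B))}"

definition has_ham_cycle :: "nat \<Rightarrow> nat set set \<Rightarrow> bool" where
  "has_ham_cycle n M \<longleftrightarrow> n \<ge> 3 \<and>
     (\<exists>vs. distinct vs \<and> set vs = {..<n} \<and>
        (\<forall>i<n. {vs ! i, vs ! ((i + 1) mod n)} \<in> M))"

(* maker_wins_within n b k M B: in the position where Maker owns M, Breaker owns B and
   it is Breaker's turn, Maker can force that his graph contains a Hamilton cycle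
   after at most k further moves of his. *)
fun maker_wins_within :: "nat \<Rightarrow> nat \<Rightarrow> nat \<Rightarrow> nat set set \<Rightarrow> nat set set \<Rightarrow> bool" where
  "maker_wins_within n b 0 M B = has_ham_cycle n M"
| "maker_wins_within n b (Suc k) M B =
     (has_ham_cycle n M \<or>
      (\<forall>S \<in> breaker_moves n b M B.
         \<exists>e \<in> free_edges n M (B \<union> S). maker_wins_within n b k (insert e M) (B \<union> S)))"

end

theory Submission
  imports Defs "HOL-Library.Sublist" "HOL-Real_Asymp.Real_Asymp"
begin

text \<open>
  Maker first builds an expander in \<open>12 * n\<close> moves: he always plays at the most dangerous vertex
  \<open>v\<close> at which he has chosen fewer than \<open>12\<close> edges, where danger is the Breaker degree minus
  \<open>2 * b\<close> times the number of edges chosen at \<open>v\<close>. Bounding the average danger of every set of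
  unsatisfied vertices in terms of its size, as in the minimum degree game of Gebauer and Szabo,
  shows that every such \<open>v\<close> keeps at least \<open>n / ln n powr (1/4)\<close> available endpoints. If Maker chose
  uniformly among them, then with positive probability all sets of size up to about
  \<open>7 * n / sqrt (ln n)\<close> would expand by a factor of two; he derandomises this choice by never
  increasing the expected number of pairs \<open>(U, W)\<close> with \<open>card W = 2 * card U\<close> such that all edges
  chosen at \<open>U\<close> stay inside \<open>U \<union> W\<close>.

  In an expander, Posa rotations of a longest path yield quadratically many pairs whose addition
  closes a path of the same length to a cycle, more than Breaker can occupy within the whole game.
  A cycle that is not Hamiltonian extends to a longer path, either by an existing edge or, if no
  edge leaves it, by one of the many free edges leaving it. So every two moves lengthen the longest
  path, and \<open>2 * n\<close> further moves suffice.
\<close>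

section \<open>Adjacent entries of a list\<close>

definition adjacent :: "'a list \<Rightarrow> 'a \<Rightarrow> 'a \<Rightarrow> bool" where
  "adjacent xs a b \<longleftrightarrow> sublist [a, b] xs \<or> sublist [b, a] xs"

lemma adjacent_rev [simp]: "adjacent (rev xs) = adjacent xs"
  by (auto simp: adjacent_def sublist_rev_right fun_eq_iff)

lemma adjacent_append:
  "adjacent (xs @ ys) a b \<longleftrightarrow> adjacent xs a b \<or> adjacent ys a b \<or>
     (xs \<noteq> [] \<and> ys \<noteq> [] \<and> (a = last xs \<and> b = hd ys \<or> b = last xs \<and> a = hd ys))"
proof -
  have "sublist [u, v] (xs @ ys) \<longleftrightarrow> sublist [u, v] xs \<or> sublist [u, v] ys \<or>
      (xs \<noteq> [] \<and> ys \<noteq> [] \<and> u = last xs \<and> v = hd ys)" for u v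
  proof -
    have "suffix [u] xs \<longleftrightarrow> xs \<noteq> [] \<and> u = last xs"
      by (cases xs rule: rev_cases) auto
    moreover have "prefix [v] ys \<longleftrightarrow> ys \<noteq> [] \<and> v = hd ys"
      by (cases ys) auto
    moreover have "(\<exists>us vs. [u, v] = us @ vs \<and> suffix us xs \<and> prefix vs ys) \<longleftrightarrow>
        prefix [u, v] ys \<or> suffix [u] xs \<and> prefix [v] ys \<or> suffix [u, v] xs"
      by (auto simp: Cons_eq_append_conv intro: exI[of _ "[]"] exI[of _ "[u, v]"])
    ultimately show ?thesis
      unfolding sublist_append by blast
  qed
  then show ?thesis
    by (auto simp: adjacent_def)
qed

lemma adjacent_split:
  assumes "a \<notin> set xs" "a \<notin> set ys"
  shows "{b. adjacent (xs @ a # ys) a b} = set (take 1 (rev xs)) \<union> set (take 1 ys)"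
proof -
  have "\<not> adjacent zs a b" if "a \<notin> set zs" for zs b
    using that set_mono_sublist by (fastforce simp: adjacent_def)
  moreover have "\<not> adjacent [a] a b" for b
    by (simp add: adjacent_def sublist_Cons_right)
  ultimately have "adjacent (xs @ a # ys) a b \<longleftrightarrow>
      (xs \<noteq> [] \<and> b = last xs) \<or> (ys \<noteq> [] \<and> b = hd ys)" for b
    using adjacent_append[of xs "[a] @ ys" a b] adjacent_append[of "[a]" ys a b] assms by auto
  then show ?thesis
    by (cases xs rule: rev_cases; cases ys) auto
qed

lemma
  assumes "distinct xs" "a \<in> set xs"
  shows finite_adjacent: "finite {b. adjacent xs a b}"
    and card_adjacent:
      "card {b. adjacent xs a b} = (if a = hd xs then 0 else 1) + (if a = last xs then 0 else 1)"
proof -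
  obtain us vs where xs: "xs = us @ a # vs"
    using assms(2) by (auto simp: in_set_conv_decomp)
  have nbrs: "{b. adjacent xs a b} = set (take 1 (rev us)) \<union> set (take 1 vs)"
    using assms(1) unfolding xs by (intro adjacent_split) auto
  have ends: "a = hd xs \<longleftrightarrow> us = []" "a = last xs \<longleftrightarrow> vs = []"
    using assms(1) unfolding xs by (cases us; cases vs rule: rev_cases; auto)+
  show "finite {b. adjacent xs a b}"
    unfolding nbrs by simp
  show "card {b. adjacent xs a b} = (if a = hd xs then 0 else 1) + (if a = last xs then 0 else 1)"
    using assms(1) unfolding nbrs ends unfolding xs by (cases us rule: rev_cases; cases vs) auto
qed

section \<open>Longest paths in expanders\<close>

definition path_in :: "'a set \<Rightarrow> 'a set set \<Rightarrow> 'a list \<Rightarrow> bool" where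
  "path_in V M P \<longleftrightarrow>
     P \<noteq> [] \<and> distinct P \<and> set P \<subseteq> V \<and> successively (\<lambda>a b. {a, b} \<in> M) P"

definition longest_path :: "'a set \<Rightarrow> 'a set set \<Rightarrow> 'a list \<Rightarrow> bool" where
  "longest_path V M P \<longleftrightarrow> path_in V M P \<and> (\<forall>Q. path_in V M Q \<longrightarrow> length Q \<le> length P)"

definition nbhd :: "'a set \<Rightarrow> 'a set set \<Rightarrow> 'a set \<Rightarrow> 'a set" where
  "nbhd V M U = {x \<in> V - U. \<exists>y\<in>U. {y, x} \<in> M}"

definition expander :: "'a set \<Rightarrow> nat \<Rightarrow> 'a set set \<Rightarrow> bool" where
  "expander V k M \<longleftrightarrow>
     (\<forall>U\<subseteq>V. U \<noteq> {} \<longrightarrow> card U \<le> k \<longrightarrow> 2 * card U \<le> card (nbhd V M U))"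

lemma path_in_rev: "path_in V M P \<Longrightarrow> path_in V M (rev P)"
  by (auto simp: path_in_def insert_commute)

lemma path_in_mono: "path_in V M P \<Longrightarrow> M \<subseteq> M' \<Longrightarrow> path_in V M' P"
  unfolding path_in_def by (meson in_mono successively_mono)

lemma path_in_length_le: "finite V \<Longrightarrow> path_in V M P \<Longrightarrow> length P \<le> card V"
  unfolding path_in_def by (metis card_mono distinct_card)

lemma path_in_snoc:
  "path_in V M P \<Longrightarrow> x \<in> V \<Longrightarrow> x \<notin> set P \<Longrightarrow> {last P, x} \<in> M \<Longrightarrow> path_in V M (P @ [x])"
  by (auto simp: path_in_def successively_append_iff)

lemma path_in_ends: "path_in V M P \<Longrightarrow> hd P \<in> V \<and> last P \<in> V"
  unfolding path_in_def using hd_in_set last_in_set by blast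

lemma longest_path_exists:
  assumes "finite V" "path_in V M P"
  obtains Q where "longest_path V M Q" "length P \<le> length Q"
proof -
  have "\<forall>Q. path_in V M Q \<longrightarrow> length Q < Suc (card V)"
    using path_in_length_le[OF assms(1)] by (simp add: less_Suc_eq_le)
  from ex_has_greatest_nat[OF assms(2) this] show ?thesis
    using assms(2) that unfolding longest_path_def by blast
qed

lemma longest_path_last_neighbour:
  assumes "longest_path V M P" "x \<in> V" "{last P, x} \<in> M"
  shows "x \<in> set P"
proof (rule ccontr)
  assume "x \<notin> set P"
  then have "path_in V M (P @ [x])"
    using assms by (intro path_in_snoc) (auto simp: longest_path_def)
  then show False
    using assms(1) by (fastforce simp: longest_path_def)
qed

lemma expander_mono:
  assumes "finite V" "expander V k M" "M \<subseteq> M'"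
  shows "expander V k M'"
proof -
  have "card (nbhd V M U) \<le> card (nbhd V M' U)" for U
    using assms(1,3) by (intro card_mono) (auto simp: nbhd_def)
  then show ?thesis
    using assms(2) unfolding expander_def by (meson le_trans)
qed

inductive rotated :: "'a set set \<Rightarrow> 'a list \<Rightarrow> 'a list \<Rightarrow> bool" for M P where
  start: "rotated M P P"
| rotate: "rotated M P (xs @ x # ys) \<Longrightarrow> ys \<noteq> [] \<Longrightarrow> {x, last ys} \<in> M \<Longrightarrow>
    rotated M P (xs @ x # rev ys)"

definition rotation_ends :: "'a set set \<Rightarrow> 'a list \<Rightarrow> 'a set" where
  "rotation_ends M P = last ` {Q. rotated M P Q}"

lemma last_rotated: "rotated M P Q \<Longrightarrow> last Q \<in> rotation_ends M P"
  by (simp add: rotation_ends_def)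

lemma rotated_path_in:
  assumes "rotated M P Q" "path_in V M P"
  shows "path_in V M Q \<and> set Q = set P \<and> length Q = length P \<and> hd Q = hd P"
  using assms
proof (induction rule: rotated.induct)
  case (rotate xs x ys)
  have "successively (\<lambda>a b. {a, b} \<in> M) (rev ys)"
    using rotate
    by (auto simp: path_in_def successively_append_iff successively_Cons insert_commute)
  then show ?case
    using rotate
    by (auto simp: path_in_def successively_append_iff successively_Cons hd_rev hd_append)
qed auto

lemma rotation_ends_subset: "path_in V M P \<Longrightarrow> rotation_ends M P \<subseteq> set P"
  using rotated_path_in by (fastforce simp: rotation_ends_def path_in_def)

lemma hd_tail_in_rotation_ends:
  assumes "rotated M P (xs @ x # ys)" "ys \<noteq> []" "{x, last ys} \<in> M"
  shows "hd ys \<in> rotation_ends M P"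
  using last_rotated[OF rotated.rotate[OF assms]] assms(2) by (simp add: last_rev)

lemma rotated_adjacent:
  assumes "rotated M P Q" "adjacent P a b"
  shows "adjacent Q a b \<or> a \<in> rotation_ends M P \<or> b \<in> rotation_ends M P"
  using assms
proof (induction rule: rotated.induct)
  case (rotate xs x ys)
  note new_end = hd_tail_in_rotation_ends[OF rotate.hyps]
  show ?case
    using rotate.IH[OF rotate.prems] adjacent_append[of "xs @ [x]" ys a b]
      adjacent_append[of "xs @ [x]" "rev ys" a b] new_end by auto
qed simp

text \<open>
  Otherwise the path neighbours of \<open>x\<close> stay the same under all rotations, and the rotation that \<open>x\<close>
  permits makes one of them an end.
\<close>

lemma nbhd_rotation_ends:
  assumes "longest_path V M P" "x \<in> nbhd V M (rotation_ends M P)"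
  shows "\<exists>z\<in>rotation_ends M P. adjacent P z x"
proof (rule ccontr)
  let ?R = "rotation_ends M P"
  assume no_end: "\<not> ?thesis"
  have P: "path_in V M P"
    using assms(1) by (simp add: longest_path_def)
  obtain Q where Q: "rotated M P Q" and edge: "{last Q, x} \<in> M" and x: "x \<in> V" "x \<notin> ?R"
    using assms(2) by (auto simp: nbhd_def rotation_ends_def)
  note Q_path = rotated_path_in[OF Q P]
  then have "longest_path V M Q"
    using assms(1) by (simp add: longest_path_def)
  then have x_in: "x \<in> set Q"
    using x(1) edge by (rule longest_path_last_neighbour)
  have not_last: "x \<noteq> last P" "x \<noteq> last Q"
    using x(2) last_rotated[OF Q] last_rotated[OF rotated.start] by blast+
  obtain xs ys where split: "Q = xs @ x # ys"
    using x_in by (auto simp: in_set_conv_decomp)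
  have "ys \<noteq> []"
    using not_last(2) split by auto
  then have "hd ys \<in> ?R"
    using hd_tail_in_rotation_ends[of M P xs x ys] Q edge unfolding split
    by (simp add: insert_commute)
  moreover have "adjacent Q x (hd ys)"
    using \<open>ys \<noteq> []\<close> adjacent_append[of "xs @ [x]" ys] unfolding split by simp
  moreover have "{z. adjacent P x z} = {z. adjacent Q x z}"
  proof (rule card_subset_eq)
    show "{z. adjacent P x z} \<subseteq> {z. adjacent Q x z}"
      using rotated_adjacent[OF Q] no_end x(2) by (auto simp: adjacent_def)
    show "finite {z. adjacent Q x z}" "card {z. adjacent P x z} = card {z. adjacent Q x z}"
      using Q_path P x_in not_last by (auto simp: path_in_def finite_adjacent card_adjacent)
  qed
  ultimately show False
    using no_end by (auto simp: adjacent_def)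
qed

lemma posa_lemma:
  assumes "longest_path V M P"
  shows "card (nbhd V M (rotation_ends M P)) < 2 * card (rotation_ends M P)"
proof -
  let ?R = "rotation_ends M P" and ?N = "\<lambda>z. {x. adjacent P z x}"
  have P: "path_in V M P"
    using assms by (simp add: longest_path_def)
  have R: "?R \<subseteq> set P" "last P \<in> ?R" "finite ?R"
    using rotation_ends_subset[OF P] last_rotated[OF rotated.start] finite_subset by blast+
  have card_N: "finite (?N z)" "card (?N z) \<le> (if z = last P then 1 else 2)" if "z \<in> ?R" for z
    using P R(1) that finite_adjacent[of P z] card_adjacent[of P z]
    by (auto simp: path_in_def)
  have "nbhd V M ?R \<subseteq> (\<Union>z\<in>?R. ?N z)"
    using nbhd_rotation_ends[OF assms] by blast
  then have "card (nbhd V M ?R) \<le> card (\<Union>z\<in>?R. ?N z)"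
    using R(3) card_N(1) by (intro card_mono) auto
  also have "\<dots> \<le> (\<Sum>z\<in>?R. card (?N z))"
    using R(3) by (rule card_UN_le)
  also have "\<dots> \<le> (\<Sum>z\<in>?R. if z = last P then 1 else 2)"
    using card_N(2) by (intro sum_mono)
  also have "\<dots> < (\<Sum>z\<in>?R. 2)"
    using R by (intro sum_strict_mono_ex1) auto
  finally show ?thesis
    by (simp add: mult.commute)
qed

lemma card_rotation_ends:
  assumes "longest_path V M P" "expander V k M"
  shows "k < card (rotation_ends M P)"
proof (rule ccontr)
  assume "\<not> k < card (rotation_ends M P)"
  moreover have "rotation_ends M P \<subseteq> V"
    using assms(1) rotation_ends_subset unfolding longest_path_def path_in_def by blast
  moreover have "rotation_ends M P \<noteq> {}"
    using last_rotated[OF rotated.start] by blast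
  ultimately have "2 * card (rotation_ends M P) \<le> card (nbhd V M (rotation_ends M P))"
    using assms(2) by (simp add: expander_def)
  then show False
    using posa_lemma[OF assms(1)] by simp
qed

lemma longest_path_length_gt:
  assumes "longest_path V M P" "expander V k M"
  shows "k < length P"
proof -
  have "path_in V M P"
    using assms(1) by (simp add: longest_path_def)
  then have "card (rotation_ends M P) \<le> length P"
    using rotation_ends_subset card_mono card_length by (metis List.finite_set le_trans)
  with card_rotation_ends[OF assms] show ?thesis
    by simp
qed

section \<open>Edges that close a longest path\<close>

definition closing_pairs :: "'a set \<Rightarrow> 'a set set \<Rightarrow> nat \<Rightarrow> ('a \<times> 'a) set" where
  "closing_pairs V M l = {(hd Q, last Q) | Q. path_in V M Q \<and> length Q = l}"

definition closing_edges :: "'a set \<Rightarrow> 'a set set \<Rightarrow> nat \<Rightarrow> 'a set set" where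
  "closing_edges V M l = (\<lambda>(u, v). {u, v}) ` closing_pairs V M l"

lemma closing_pairs_subset: "closing_pairs V M l \<subseteq> V \<times> V"
  using path_in_ends by (auto simp: closing_pairs_def)

lemma finite_closing_pairs: "finite V \<Longrightarrow> finite (closing_pairs V M l)"
  using closing_pairs_subset by (rule finite_subset) simp

lemma closing_edgesE:
  assumes "e \<in> closing_edges V M l"
  obtains Q where "path_in V M Q" "length Q = l" "e = {last Q, hd Q}"
  using assms by (auto simp: closing_edges_def closing_pairs_def insert_commute)

lemma card_le_twice_card_unordered:
  assumes "finite R"
  shows "card R \<le> 2 * card ((\<lambda>(u, v). {u, v}) ` R)"
proof -
  let ?f = "\<lambda>(u, v). {u, v}" and ?T = "(\<lambda>(u, v). {u, v}) ` R"
  let ?g = "inv_into R ?f"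
  have "R \<subseteq> ?g ` ?T \<union> prod.swap ` ?g ` ?T"
  proof clarify
    fix u v assume uv: "(u, v) \<in> R" "(u, v) \<notin> prod.swap ` ?g ` ?T"
    have "?f (?g {u, v}) = {u, v}" and "?g {u, v} \<in> ?g ` ?T"
      using uv(1) f_inv_into_f[of "{u, v}" ?f R] by force+
    then show "(u, v) \<in> ?g ` ?T"
      using uv(2) by (cases "?g {u, v}") (force simp: doubleton_eq_iff image_iff)
  qed
  then have "card R \<le> card (?g ` ?T \<union> prod.swap ` ?g ` ?T)"
    using assms by (intro card_mono) auto
  also have "\<dots> \<le> card ?T + card ?T"
    using assms by (intro order.trans[OF card_Un_le] add_mono)
      (auto intro: card_image_le order.trans[OF card_image_le])
  finally show ?thesis
    by simp
qed

lemma rotation_ends_subset_closing_pairs: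
  assumes "path_in V M P"
  shows "rotation_ends M P \<subseteq> closing_pairs V M (length P) `` {hd P}"
proof
  fix z assume "z \<in> rotation_ends M P"
  then obtain Q where "rotated M P Q" "z = last Q"
    by (auto simp: rotation_ends_def)
  then show "z \<in> closing_pairs V M (length P) `` {hd P}"
    using rotated_path_in[of M P Q V] assms by (auto simp: closing_pairs_def intro!: exI[of _ Q])
qed

lemma card_closing_pairs_Image:
  assumes "finite V" "longest_path V M P" "expander V k M" and w: "w \<in> rotation_ends M P"
  shows "k < card (closing_pairs V M (length P) `` {w})"
proof -
  obtain Q where Q: "rotated M P Q" "w = last Q"
    using w unfolding rotation_ends_def by blast
  have "path_in V M Q \<and> length Q = length P"
    using rotated_path_in[OF Q(1), of V] assms(2) by (simp add: longest_path_def)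
  then have rev_Q: "path_in V M (rev Q)" "length (rev Q) = length P" "hd (rev Q) = w"
    using Q(2) path_in_rev[of V M Q] by (auto simp: hd_rev)
  then have "longest_path V M (rev Q)"
    using assms(2) by (simp add: longest_path_def)
  then have "k < card (rotation_ends M (rev Q))"
    using assms(3) by (rule card_rotation_ends)
  also have "\<dots> \<le> card (closing_pairs V M (length P) `` {w})"
    using rotation_ends_subset_closing_pairs[OF rev_Q(1)] rev_Q(2,3)
    by (intro card_mono finite_Image finite_closing_pairs assms(1)) simp
  finally show ?thesis .
qed

lemma card_closing_pairs:
  assumes "finite V" "longest_path V M P" "expander V k M"
  shows "k * k < card (closing_pairs V M (length P))"
proof -
  let ?C = "closing_pairs V M (length P)" and ?R = "rotation_ends M P"
  have fin: "finite ?C" "finite (?C `` {w})" for w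
    using finite_closing_pairs[OF assms(1)] finite_Image by auto
  have "k < card ?R"
    using assms(2,3) by (rule card_rotation_ends)
  then have "finite ?R"
    using card.infinite by fastforce
  have "k * k < card ?R * Suc k"
    using \<open>k < card ?R\<close> by (intro mult_strict_mono) auto
  also have "\<dots> \<le> (\<Sum>w\<in>?R. card (?C `` {w}))"
    using sum_bounded_below[of ?R "Suc k" "\<lambda>w. card (?C `` {w})"]
      card_closing_pairs_Image[OF assms] by (simp add: Suc_le_eq)
  also have "\<dots> = card (SIGMA w:?R. ?C `` {w})"
    using \<open>finite ?R\<close> fin by (simp add: card_SigmaI)
  also have "\<dots> \<le> card ?C"
    using fin(1) by (intro card_mono) auto
  finally show ?thesis .
qed

lemma card_closing_edges:
  assumes "finite V" "longest_path V M P" "expander V k M"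
  shows "k * k < 2 * card (closing_edges V M (length P))"
  using less_le_trans[OF card_closing_pairs[OF assms]
      card_le_twice_card_unordered[OF finite_closing_pairs[OF assms(1)]]]
  by (simp add: closing_edges_def)

lemma closed_path_extend:
  assumes "path_in V M P" "{last P, hd P} \<in> M"
    and "y \<in> set P" "x \<in> V - set P" "{y, x} \<in> M"
  shows "\<exists>Q. path_in V M Q \<and> length Q = Suc (length P)"
proof -
  obtain us ws where split: "P = us @ y # ws"
    using assms(3) by (auto simp: in_set_conv_decomp)
  let ?Q = "ws @ us @ [y]"
  have "successively (\<lambda>a b. {a, b} \<in> M) ?Q"
    using assms(1,2) unfolding split path_in_def
    by (auto simp: successively_append_iff successively_Cons hd_append split: if_splits)
  then have "path_in V M ?Q"
    using assms(1) unfolding split path_in_def by auto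
  then have "path_in V M (?Q @ [x])"
    using assms(4,5) by (intro path_in_snoc) (auto simp: split)
  then show ?thesis
    by (intro exI[of _ "?Q @ [x]"]) (simp add: split)
qed

lemma isolated_set_large:
  assumes "finite V" "expander V k M" "U \<subseteq> V" "U \<noteq> {}" "nbhd V M U = {}"
  shows "k < card U"
proof (rule ccontr)
  assume "\<not> k < card U"
  then have "2 * card U \<le> 0"
    using assms unfolding expander_def by (metis card.empty not_le)
  then show False
    using assms(1,3,4) finite_subset by fastforce
qed

lemma card_edges_leaving_isolated_set:
  assumes "finite V" "expander V k M" "U \<subset> V" "U \<noteq> {}" "nbhd V M U = {}"
  shows "k * k < card {{u, w} | u w. u \<in> U \<and> w \<in> V - U}"
proof -
  have "nbhd V M (V - U) = {}"
    using assms(3,5) by (fastforce simp: nbhd_def insert_commute)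
  then have "k < card (V - U)" "k < card U"
    using assms by (intro isolated_set_large[of V k M]; auto)+
  then have "k * k < card (U \<times> (V - U))"
    by (simp add: card_cartesian_product mult_strict_mono')
  also have "\<dots> = card ((\<lambda>(u, w). {u, w}) ` (U \<times> (V - U)))"
    by (intro card_image[symmetric]) (auto simp: inj_on_def doubleton_eq_iff)
  also have "(\<lambda>(u, w). {u, w}) ` (U \<times> (V - U)) = {{u, w} | u w. u \<in> U \<and> w \<in> V - U}"
    by auto
  finally show ?thesis .
qed

section \<open>Closing a Hamilton cycle\<close>

lemma finite_Kn_edges [simp]: "finite (Kn_edges n)"
proof -
  have "Kn_edges n \<subseteq> Pow {..<n}"
    by (auto simp: Kn_edges_def)
  then show ?thesis
    by (simp add: finite_subset)
qed

lemma Kn_edgesI: "u < n \<Longrightarrow> v < n \<Longrightarrow> u \<noteq> v \<Longrightarrow> {u, v} \<in> Kn_edges n"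
  by (auto simp: Kn_edges_def)

lemma breaker_movesD:
  assumes "S \<in> breaker_moves n b M B"
  shows "S \<subseteq> Kn_edges n" "card S \<le> b"
  using assms by (auto simp: breaker_moves_def free_edges_def)

lemma maker_wins_within_ham_cycle: "has_ham_cycle n M \<Longrightarrow> maker_wins_within n b k M B"
  by (cases k) auto

lemma maker_wins_within_mono:
  assumes "maker_wins_within n b k M B" "k \<le> k'"
  shows "maker_wins_within n b k' M B"
  using assms
proof (induction k arbitrary: k' M B)
  case 0
  then show ?case
    by (simp add: maker_wins_within_ham_cycle)
next
  case (Suc k)
  then obtain j where "k' = Suc j" "k \<le> j"
    using Suc_le_D by blast
  with Suc show ?case
    by (auto; meson)
qed

lemma ham_cycle_of_closed_path:
  assumes "path_in {..<n} M P" "{last P, hd P} \<in> M" "length P = n" "3 \<le> n"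
  shows "has_ham_cycle n M"
proof -
  have "set P = {..<n}"
    using assms(1,3) unfolding path_in_def
    by (metis card_lessThan card_subset_eq distinct_card finite_lessThan)
  moreover have "{P ! i, P ! ((i + 1) mod n)} \<in> M" if "i < n" for i
  proof (cases "Suc i < n")
    case True
    then show ?thesis
      using assms(1,3) by (auto simp: path_in_def successively_conv_nth)
  next
    case False
    then have "i = n - 1"
      using that by simp
    then show ?thesis
      using assms by (auto simp: path_in_def last_conv_nth hd_conv_nth)
  qed
  ultimately show ?thesis
    using assms unfolding has_ham_cycle_def path_in_def by blast
qed

text \<open>
  By the last conjunct Breaker cannot occupy, within the next \<open>k\<close> turns, all of the more than
  \<open>q * q / 2\<close> useful edges that an expander offers.
\<close>

definition endgame_position :: "nat \<Rightarrow> nat \<Rightarrow> nat \<Rightarrow> nat \<Rightarrow> nat set set \<Rightarrow> nat set set \<Rightarrow> bool" where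
  "endgame_position n b q k M B \<longleftrightarrow>
     expander {..<n} q M \<and> B \<subseteq> Kn_edges n \<and> 2 * (card B + b * k) \<le> q * q"

lemma endgame_position_antimono:
  assumes "endgame_position n b q k' M B" "k \<le> k'"
  shows "endgame_position n b q k M B"
proof -
  have "2 * (card B + b * k) \<le> 2 * (card B + b * k')"
    using assms(2) by simp
  with assms(1) show ?thesis
    unfolding endgame_position_def using order.trans by blast
qed

lemma maker_wins_by_claiming:
  assumes pos: "endgame_position n b q (Suc k) M B"
    and useful: "T \<subseteq> Kn_edges n - M" "q * q < 2 * card T"
    and win: "\<And>e B'. e \<in> T \<Longrightarrow> endgame_position n b q k (insert e M) B' \<Longrightarrow>
      maker_wins_within n b k (insert e M) B'"
  shows "maker_wins_within n b (Suc k) M B"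
proof -
  have "\<exists>e\<in>free_edges n M (B \<union> S). maker_wins_within n b k (insert e M) (B \<union> S)"
    if "S \<in> breaker_moves n b M B" for S
  proof -
    note S = breaker_movesD[OF that]
    have BS: "B \<union> S \<subseteq> Kn_edges n"
      using pos S(1) by (simp add: endgame_position_def)
    have "card (B \<union> S) \<le> card B + b"
      using card_Un_le[of B S] S(2) by linarith
    then have budget: "2 * (card (B \<union> S) + b * k) \<le> q * q"
      using pos by (simp add: endgame_position_def)
    then have "card (B \<union> S) < card T"
      using le_less_trans[OF _ useful(2)] by fastforce
    then obtain e where e: "e \<in> T" "e \<notin> B \<union> S"
      using card_mono[OF finite_subset[OF BS finite_Kn_edges], of T] by auto
    have "endgame_position n b q k (insert e M) (B \<union> S)"
      using pos BS budget expander_mono[of "{..<n}" q M "insert e M"]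
      by (auto simp: endgame_position_def)
    then have "maker_wins_within n b k (insert e M) (B \<union> S)"
      by (rule win[OF e(1)])
    moreover have "e \<in> free_edges n M (B \<union> S)"
      using e useful(1) by (auto simp: free_edges_def)
    ultimately show ?thesis
      by blast
  qed
  then show ?thesis
    by simp
qed

lemma closing_edges_subset_Kn_edges:
  assumes "2 \<le> l"
  shows "closing_edges {..<n} M l \<subseteq> Kn_edges n"
proof
  fix e assume "e \<in> closing_edges {..<n} M l"
  then obtain Q where Q: "path_in {..<n} M Q" "length Q = l" "e = {last Q, hd Q}"
    by (rule closing_edgesE)
  have "last Q \<noteq> hd Q"
    using Q(1,2) assms by (cases Q) (auto simp: path_in_def)
  then show "e \<in> Kn_edges n"
    using Q(3) path_in_ends[OF Q(1)] by (auto intro: Kn_edgesI)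
qed

lemma maker_wins_from_longest_path:
  assumes pos: "endgame_position n b q (Suc k) M B" and "0 < q"
    and P: "longest_path {..<n} M P"
    and win: "\<And>M' B' Q. endgame_position n b q k M' B' \<Longrightarrow> path_in {..<n} M' Q \<Longrightarrow>
      {last Q, hd Q} \<in> M' \<Longrightarrow> length Q = length P \<Longrightarrow> maker_wins_within n b k M' B'"
  shows "maker_wins_within n b (Suc k) M B"
proof (cases "closing_edges {..<n} M (length P) \<inter> M = {}")
  case False
  then obtain Q where "path_in {..<n} M Q" "length Q = length P" "{last Q, hd Q} \<in> M"
    by (auto elim: closing_edgesE)
  with win endgame_position_antimono[OF pos, of k] have "maker_wins_within n b k M B"
    by simp
  then show ?thesis
    by (rule maker_wins_within_mono) simp
next
  case True
  have ex: "expander {..<n} q M"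
    using pos by (simp add: endgame_position_def)
  have "2 \<le> length P"
    using longest_path_length_gt[OF P ex] \<open>0 < q\<close> by simp
  show ?thesis
  proof (rule maker_wins_by_claiming[OF pos])
    show "q * q < 2 * card (closing_edges {..<n} M (length P))"
      using P ex by (intro card_closing_edges) auto
    show "closing_edges {..<n} M (length P) \<subseteq> Kn_edges n - M"
      using True closing_edges_subset_Kn_edges[OF \<open>2 \<le> length P\<close>] by blast
  next
    fix e B' assume e: "e \<in> closing_edges {..<n} M (length P)"
      and pos': "endgame_position n b q k (insert e M) B'"
    obtain Q where "path_in {..<n} M Q" "length Q = length P" "e = {last Q, hd Q}"
      using e by (rule closing_edgesE)
    then show "maker_wins_within n b k (insert e M) B'"
      using path_in_mono[OF _ subset_insertI] by (intro win[OF pos', of Q]) auto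
  qed
qed

lemma maker_wins_by_leaving_isolated_set:
  assumes pos: "endgame_position n b q (Suc k) M B"
    and U: "U \<subset> {..<n}" "U \<noteq> {}" "nbhd {..<n} M U = {}"
    and win: "\<And>u w B'. u \<in> U \<Longrightarrow> w \<in> {..<n} - U \<Longrightarrow>
      endgame_position n b q k (insert {u, w} M) B' \<Longrightarrow>
      maker_wins_within n b k (insert {u, w} M) B'"
  shows "maker_wins_within n b (Suc k) M B"
proof (rule maker_wins_by_claiming[OF pos])
  let ?T = "{{u, w} | u w. u \<in> U \<and> w \<in> {..<n} - U}"
  have "q * q < card ?T"
    using pos U by (intro card_edges_leaving_isolated_set) (auto simp: endgame_position_def)
  then show "q * q < 2 * card ?T"
    by simp
  show "?T \<subseteq> Kn_edges n - M"
    using U by (fastforce simp: nbhd_def intro: Kn_edgesI)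
  show "maker_wins_within n b k (insert e M) B'"
    if "e \<in> ?T" "endgame_position n b q k (insert e M) B'" for e B'
    using that win by blast
qed

lemma maker_wins_from_closed_path:
  assumes pos: "endgame_position n b q (Suc k) M B" and "3 \<le> n"
    and P: "path_in {..<n} M P" "{last P, hd P} \<in> M"
    and win: "\<And>M' B' Q. endgame_position n b q k M' B' \<Longrightarrow> path_in {..<n} M' Q \<Longrightarrow>
      length Q = Suc (length P) \<Longrightarrow> maker_wins_within n b k M' B'"
  shows "maker_wins_within n b (Suc k) M B"
proof -
  have extend: "maker_wins_within n b k M' B'"
    if "endgame_position n b q k M' B'" "M \<subseteq> M'" "y \<in> set P" "x \<in> {..<n} - set P" "{y, x} \<in> M'"
    for M' B' x y
    using that win closed_path_extend[of "{..<n}" M' P y x] P path_in_mono[of "{..<n}" M P M']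
    by blast
  consider (spanning) "set P = {..<n}" | (edge_leaves) "nbhd {..<n} M (set P) \<noteq> {}"
    | (isolated) "set P \<subset> {..<n}" "nbhd {..<n} M (set P) = {}"
    using P(1) by (auto simp: path_in_def)
  then show ?thesis
  proof cases
    case spanning
    then have "length P = n"
      using P(1) distinct_card by (fastforce simp: path_in_def)
    with P \<open>3 \<le> n\<close> show ?thesis
      by (intro maker_wins_within_ham_cycle ham_cycle_of_closed_path)
  next
    case edge_leaves
    then obtain x y where "y \<in> set P" "x \<in> {..<n} - set P" "{y, x} \<in> M"
      by (auto simp: nbhd_def)
    with extend endgame_position_antimono[OF pos, of k] have "maker_wins_within n b k M B"
      by auto
    then show ?thesis
      by (rule maker_wins_within_mono) simp
  next
    case isolated
    have "set P \<noteq> {}"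
      using P(1) by (simp add: path_in_def)
    from maker_wins_by_leaving_isolated_set[OF pos isolated(1) this isolated(2)] extend show ?thesis
      by blast
  qed
qed

lemma maker_wins_from_path:
  assumes "3 \<le> n" "0 < q"
  shows "endgame_position n b q (2 * j + 1) M B \<Longrightarrow> path_in {..<n} M P \<Longrightarrow> n \<le> length P + j \<Longrightarrow>
    maker_wins_within n b (2 * j + 1) M B"
proof (induction j arbitrary: M B P)
  case 0
  obtain Q where Q: "longest_path {..<n} M Q" "length P \<le> length Q"
    using longest_path_exists[OF _ "0.prems"(2)] by auto
  have "maker_wins_within n b (Suc 0) M B"
  proof (rule maker_wins_from_longest_path[OF _ \<open>0 < q\<close> Q(1)])
    fix M' B' R assume R: "path_in {..<n} M' R" "{last R, hd R} \<in> M'" "length R = length Q"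
    then have "length R = n"
      using path_in_length_le[OF _ R(1)] Q(2) "0.prems"(3) by simp
    with R \<open>3 \<le> n\<close> show "maker_wins_within n b 0 M' B'"
      by (auto intro: ham_cycle_of_closed_path)
  qed (use "0.prems"(1) in simp)
  then show ?case
    by simp
next
  case (Suc j)
  obtain Q where Q: "longest_path {..<n} M Q" "length P \<le> length Q"
    using longest_path_exists[OF _ Suc.prems(2)] by auto
  have "maker_wins_within n b (Suc (Suc (2 * j + 1))) M B"
  proof (rule maker_wins_from_longest_path[OF _ \<open>0 < q\<close> Q(1)])
    fix M' B' R assume R: "endgame_position n b q (Suc (2 * j + 1)) M' B'" "path_in {..<n} M' R"
      "{last R, hd R} \<in> M'" "length R = length Q"
    show "maker_wins_within n b (Suc (2 * j + 1)) M' B'"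
    proof (rule maker_wins_from_closed_path[OF R(1) \<open>3 \<le> n\<close> R(2,3)])
      fix M'' B'' R'
      assume "endgame_position n b q (2 * j + 1) M'' B''" "path_in {..<n} M'' R'"
        "length R' = Suc (length R)"
      then show "maker_wins_within n b (2 * j + 1) M'' B''"
        using Suc.prems(3) Q(2) R(4) by (intro Suc.IH[of M'' B'' R']) auto
    qed
  qed (use Suc.prems(1) in simp)
  then show ?case
    by simp
qed

lemma maker_wins_from_expander:
  assumes "3 \<le> n" "0 < q" "expander {..<n} q M" "B \<subseteq> Kn_edges n"
    and "2 * (card B + b * (2 * n)) \<le> q * q"
  shows "maker_wins_within n b (2 * n) M B"
proof -
  have "endgame_position n b q (2 * n) M B"
    using assms by (simp add: endgame_position_def)
  then have "endgame_position n b q (2 * (n - 1) + 1) M B"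
    by (rule endgame_position_antimono) (use assms(1) in simp)
  then have "maker_wins_within n b (2 * (n - 1) + 1) M B"
    using assms(1) by (intro maker_wins_from_path[OF assms(1,2), of _ _ _ _ "[0]"])
      (auto simp: path_in_def)
  then show ?thesis
    by (rule maker_wins_within_mono) (use assms(1) in simp)
qed

section \<open>Keeping Breaker degrees small\<close>

definition finite_graph :: "'a set set \<Rightarrow> bool" where
  "finite_graph B \<longleftrightarrow> finite B \<and> (\<forall>e\<in>B. card e = 2)"

definition degree_in :: "'a set set \<Rightarrow> 'a \<Rightarrow> nat" where
  "degree_in B v = card {e \<in> B. v \<in> e}"

definition touching :: "'a set set \<Rightarrow> 'a set \<Rightarrow> nat" where
  "touching B I = card {e \<in> B. e \<inter> I \<noteq> {}}"

lemma finite_graph_Un: "finite_graph B \<Longrightarrow> finite_graph S \<Longrightarrow> finite_graph (B \<union> S)"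
  by (auto simp: finite_graph_def)

lemma finite_graph_Kn_edges: "B \<subseteq> Kn_edges n \<Longrightarrow> finite_graph B"
  using finite_subset[of B "Kn_edges n"] by (fastforce simp: finite_graph_def Kn_edges_def)

lemma touching_singleton: "touching B {v} = degree_in B v"
  unfolding touching_def degree_in_def by (rule arg_cong[where f = card]) auto

lemma touching_le_sum_degree:
  assumes "finite I"
  shows "touching B I \<le> (\<Sum>v\<in>I. degree_in B v)"
proof -
  have "{e \<in> B. e \<inter> I \<noteq> {}} = (\<Union>v\<in>I. {e \<in> B. v \<in> e})"
    by auto
  then show ?thesis
    unfolding touching_def degree_in_def using card_UN_le[OF assms] by metis
qed

lemma touching_insert_ge:
  assumes "finite_graph B" "finite I" "v \<notin> I"
  shows "touching B I + degree_in B v \<le> touching B (insert v I) + card I"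
proof -
  let ?A = "{e \<in> B. e \<inter> I \<noteq> {}}" and ?D = "{e \<in> B. v \<in> e}"
  have "?A \<inter> ?D \<subseteq> (\<lambda>x. {v, x}) ` I"
    using assms(1,3) by (fastforce simp: finite_graph_def card_2_iff)
  then have "card (?A \<inter> ?D) \<le> card I"
    using assms(2) by (meson card_image_le card_mono finite_imageI le_trans)
  moreover have "?A \<union> ?D = {e \<in> B. e \<inter> insert v I \<noteq> {}}"
    by auto
  ultimately show ?thesis
    using card_Un_Int[of ?A ?D] assms(1)
    unfolding touching_def degree_in_def finite_graph_def by simp
qed

lemma touching_Un_le:
  assumes "finite S"
  shows "touching (B \<union> S) I \<le> touching B I + card S"
proof -
  have "{e \<in> B \<union> S. e \<inter> I \<noteq> {}} = {e \<in> B. e \<inter> I \<noteq> {}} \<union> {e \<in> S. e \<inter> I \<noteq> {}}"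
    by auto
  then have "touching (B \<union> S) I \<le> touching B I + card {e \<in> S. e \<inter> I \<noteq> {}}"
    using card_Un_le by (simp add: touching_def)
  also have "\<dots> \<le> touching B I + card S"
    using assms by (simp add: card_mono)
  finally show ?thesis .
qed

lemma degree_in_Un_le: "degree_in (B \<union> S) v \<le> degree_in B v + degree_in S v"
proof -
  have "{e \<in> B \<union> S. v \<in> e} = {e \<in> B. v \<in> e} \<union> {e \<in> S. v \<in> e}"
    by auto
  then show ?thesis
    unfolding degree_in_def by (metis card_Un_le)
qed

lemma sum_degree_le:
  assumes "finite_graph S" "finite I"
  shows "(\<Sum>v\<in>I. degree_in S v) \<le> 2 * card S"
proof -
  have "(\<Sum>v\<in>I. degree_in S v) = (\<Sum>e\<in>S. card {v \<in> I. v \<in> e})"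
    using assms unfolding degree_in_def finite_graph_def by (intro sum_multicount_gen) auto
  also have "\<dots> \<le> (\<Sum>e\<in>S. 2)"
  proof (rule sum_mono)
    fix e assume "e \<in> S"
    then have "card e = 2"
      using assms(1) by (simp add: finite_graph_def)
    moreover from this have "finite e"
      using card.infinite by force
    ultimately show "card {v \<in> I. v \<in> e} \<le> 2"
      using card_mono[of e "{v \<in> I. v \<in> e}"] by auto
  qed
  finally show ?thesis
    by simp
qed

text \<open>In the following, \<open>c v\<close> counts the edges that Maker has chosen at \<open>v\<close>.\<close>

definition danger :: "nat \<Rightarrow> 'a set set \<Rightarrow> ('a \<Rightarrow> nat) \<Rightarrow> 'a \<Rightarrow> real" where
  "danger b B c v = real (degree_in B v) - 2 * real b * real (c v)"

definition touching_danger :: "nat \<Rightarrow> 'a set set \<Rightarrow> ('a \<Rightarrow> nat) \<Rightarrow> 'a set \<Rightarrow> real" where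
  "touching_danger b B c I = real (touching B I) - 2 * real b * (\<Sum>v\<in>I. real (c v))"

text \<open>
  Sets of fewer than \<open>r\<close> vertices are measured by the number of Breaker edges touching them, which
  grows by only \<open>b\<close> per turn; for large sets the sum of degrees, growing by \<open>2 * b\<close>, is good enough.
\<close>

definition set_danger :: "nat \<Rightarrow> real \<Rightarrow> 'a set set \<Rightarrow> ('a \<Rightarrow> nat) \<Rightarrow> 'a set \<Rightarrow> real" where
  "set_danger b r B c I =
     (if r \<le> real (card I) then \<Sum>v\<in>I. danger b B c v else touching_danger b B c I)"

text \<open>
  When a set of \<open>s + 1\<close> vertices loses its most dangerous vertex, the average danger rises, Breaker's
  turn included, by at most \<open>2 * b / (s + 1)\<close> if \<open>r \<le> s\<close> and by \<open>(b + s) / (s + 1)\<close> otherwise; the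
  bound dominates the sum of these increments from \<open>n\<close> vertices down to \<open>s\<close>.
\<close>

definition danger_bound :: "nat \<Rightarrow> nat \<Rightarrow> real \<Rightarrow> nat \<Rightarrow> real" where
  "danger_bound n b r s =
     b * (ln n - ln s) + b * (ln n - ln (max r s)) + max 0 (r + 1 - s)"

definition danger_controlled ::
  "'a set \<Rightarrow> nat \<Rightarrow> real \<Rightarrow> nat \<Rightarrow> ('a \<Rightarrow> nat) \<Rightarrow> 'a set set \<Rightarrow> bool"
where
  "danger_controlled V b r d c B \<longleftrightarrow>
     (\<forall>I\<subseteq>{v \<in> V. c v < d}. I \<noteq> {} \<longrightarrow>
        set_danger b r B c I \<le> card I * danger_bound (card V) b r (card I))"

lemma touching_danger_le_sum_danger:
  assumes "finite I"
  shows "touching_danger b B c I \<le> (\<Sum>v\<in>I. danger b B c v)"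
  using of_nat_mono[OF touching_le_sum_degree[OF assms], of B, where 'a=real]
  by (simp add: touching_danger_def danger_def sum_subtractf sum_distrib_left)

lemma touching_danger_Un_le:
  assumes "finite S" "card S \<le> b"
  shows "touching_danger b (B \<union> S) c I \<le> touching_danger b B c I + b"
  using touching_Un_le[OF assms(1), of B I] assms(2) by (simp add: touching_danger_def)

lemma sum_danger_Un_le:
  assumes "finite_graph S" "card S \<le> b" "finite I"
  shows "(\<Sum>v\<in>I. danger b (B \<union> S) c v) \<le> (\<Sum>v\<in>I. danger b B c v) + 2 * b"
proof -
  have "(\<Sum>v\<in>I. degree_in (B \<union> S) v) \<le> (\<Sum>v\<in>I. degree_in B v + degree_in S v)"
    by (intro sum_mono degree_in_Un_le)
  also have "\<dots> \<le> (\<Sum>v\<in>I. degree_in B v) + 2 * b"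
    using sum_degree_le[OF assms(1,3)] assms(2) by (simp add: sum.distrib)
  finally have "real (\<Sum>v\<in>I. degree_in (B \<union> S) v) \<le> real ((\<Sum>v\<in>I. degree_in B v) + 2 * b)"
    by (rule of_nat_mono)
  then show ?thesis
    unfolding danger_def by (simp add: sum_subtractf)
qed

lemma touching_danger_insert_ge:
  assumes "finite_graph B" "finite I" "v \<notin> I"
  shows "touching_danger b B c I + danger b B c v \<le> touching_danger b B c (insert v I) + card I"
  using of_nat_mono[OF touching_insert_ge[OF assms], where 'a=real] assms(2,3)
  by (simp add: touching_danger_def danger_def algebra_simps)

lemma danger_bound_nonneg:
  assumes "0 < s" "s \<le> n" "r \<le> real n"
  shows "0 \<le> danger_bound n b r s"
proof -
  have "ln (real s) \<le> ln (real n)" "ln (max r s) \<le> ln (real n)"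
    using assms by auto
  then show ?thesis
    unfolding danger_bound_def by simp
qed

lemma one_le_Suc_mult_ln_diff:
  assumes "0 < s"
  shows "1 \<le> real (Suc s) * (ln (real (Suc s)) - ln (real s))"
  using ln_diff_le[of "real s" "real (Suc s)"] assms by (simp add: field_simps)

lemma
  fixes r :: real and n b s :: nat
  assumes "0 < s" "0 < r"
  shows danger_bound_Suc_large:
      "r \<le> s \<Longrightarrow> Suc s * danger_bound n b r (Suc s) + 2 * b \<le> Suc s * danger_bound n b r s"
    and danger_bound_Suc_small:
      "s < r \<Longrightarrow> Suc s * danger_bound n b r (Suc s) + (b + s) \<le> Suc s * danger_bound n b r s"
proof -
  let ?t = "real (Suc s)" and ?s = "real s"
  have log_gain: "b \<le> ?t * (b * (ln ?t - ln ?s))"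
    using mult_left_mono[OF one_le_Suc_mult_ln_diff[OF assms(1)], of "real b"]
    by (simp only: mult.left_commute mult_1_right of_nat_0_le_iff)
  show "?t * danger_bound n b r (Suc s) + 2 * b \<le> ?t * danger_bound n b r s" if "r \<le> s"
  proof -
    have "max r ?t = ?t" "max r ?s = ?s"
      using that by auto
    moreover have "?t * max 0 (r + 1 - ?t) \<le> ?t * max 0 (r + 1 - ?s)"
      by (intro mult_left_mono) auto
    ultimately show ?thesis
      using log_gain unfolding danger_bound_def by (simp only: distrib_left right_diff_distrib)
  qed
  show "?t * danger_bound n b r (Suc s) + (b + s) \<le> ?t * danger_bound n b r s" if "s < r"
  proof -
    have "ln (max r ?s) \<le> ln (max r ?t)"
      using assms by simp
    then have "?t * (b * ln (max r ?s)) \<le> ?t * (b * ln (max r ?t))"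
      by (intro mult_left_mono) auto
    moreover have "max 0 (r + 1 - ?t) + 1 = max 0 (r + 1 - ?s)"
      using that by simp
    then have "?t * max 0 (r + 1 - ?t) + ?t = ?t * max 0 (r + 1 - ?s)"
      by (metis distrib_left mult_1_right)
    ultimately show ?thesis
      using log_gain unfolding danger_bound_def by (simp only: distrib_left right_diff_distrib)
  qed
qed

lemma sum_insert_max_ge:
  fixes f :: "'a \<Rightarrow> real"
  assumes "finite I" "v \<notin> I" "\<And>u. u \<in> I \<Longrightarrow> f u \<le> f v"
  shows "Suc (card I) * sum f I \<le> card I * sum f (insert v I)"
  using sum_bounded_above[of I f "f v"] assms by (simp add: algebra_simps)

lemma sum_danger_without_max:
  fixes r :: real
  assumes S: "finite_graph S" "card S \<le> b" and I: "finite I" "I \<noteq> {}" "v \<notin> I"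
    and max: "\<And>u. u \<in> I \<Longrightarrow> danger b (B \<union> S) c u \<le> danger b (B \<union> S) c v"
    and r: "0 < r" "r \<le> card I"
    and old: "(\<Sum>u\<in>insert v I. danger b B c u) \<le> Suc (card I) * danger_bound n b r (Suc (card I))"
  shows "(\<Sum>u\<in>I. danger b (B \<union> S) c u) \<le> card I * danger_bound n b r (card I)"
proof -
  define s where "s = card I"
  have s: "0 < s"
    using I by (simp add: s_def card_gt_0_iff)
  have "Suc s * (\<Sum>u\<in>I. danger b (B \<union> S) c u) \<le> s * (\<Sum>u\<in>insert v I. danger b (B \<union> S) c u)"
    unfolding s_def by (rule sum_insert_max_ge[OF I(1,3)]) (rule max)
  also have "\<dots> \<le> s * ((\<Sum>u\<in>insert v I. danger b B c u) + 2 * b)"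
    using sum_danger_Un_le[OF S, of "insert v I" B c] I(1) by (intro mult_left_mono) auto
  also have "\<dots> \<le> s * (Suc s * danger_bound n b r s)"
    using old danger_bound_Suc_large[OF s r(1), of n b] r(2)
    by (intro mult_left_mono) (auto simp: s_def)
  finally have "Suc s * (\<Sum>u\<in>I. danger b (B \<union> S) c u) \<le> Suc s * (s * danger_bound n b r s)"
    by (simp only: mult.left_commute)
  then show ?thesis
    unfolding s_def by (subst (asm) mult_le_cancel_left_pos) auto
qed

lemma touching_danger_without_max:
  fixes r :: real
  assumes B: "finite_graph B" and S: "finite_graph S" "card S \<le> b"
    and I: "finite I" "I \<noteq> {}" "v \<notin> I"
    and max: "\<And>u. u \<in> I \<Longrightarrow> danger b (B \<union> S) c u \<le> danger b (B \<union> S) c v"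
    and r: "card I < r"
    and old: "touching_danger b B c (insert v I) \<le> Suc (card I) * danger_bound n b r (Suc (card I))"
  shows "touching_danger b (B \<union> S) c I \<le> card I * danger_bound n b r (card I)"
proof -
  define s where "s = card I"
  define T where "T = touching_danger b (B \<union> S) c I"
  have s: "0 < s" "0 < r"
    using I r by (auto simp: s_def card_gt_0_iff)
  have "T \<le> s * danger b (B \<union> S) c v"
    using touching_danger_le_sum_danger[OF I(1), of b "B \<union> S" c]
      sum_bounded_above[of I "danger b (B \<union> S) c", OF max] by (simp add: T_def s_def)
  then have "Suc s * T \<le> s * (T + danger b (B \<union> S) c v)"
    by (simp add: algebra_simps)
  also have "\<dots> \<le> s * (touching_danger b (B \<union> S) c (insert v I) + s)"
    unfolding T_def s_def using finite_graph_Un[OF B S(1)] I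
    by (intro mult_left_mono touching_danger_insert_ge) auto
  also have "\<dots> \<le> s * (touching_danger b B c (insert v I) + b + s)"
    using touching_danger_Un_le[of S b B c "insert v I"] S
    by (intro mult_left_mono) (auto simp: finite_graph_def)
  also have "\<dots> \<le> s * (Suc s * danger_bound n b r s)"
    using old danger_bound_Suc_small[OF s, of n b] r by (intro mult_left_mono) (auto simp: s_def)
  finally have "Suc s * T \<le> Suc s * (s * danger_bound n b r s)"
    by (simp only: mult.left_commute)
  then show ?thesis
    unfolding s_def T_def by (subst (asm) mult_le_cancel_left_pos) auto
qed

lemma set_danger_without_max:
  fixes r :: real
  assumes B: "finite_graph B" and S: "finite_graph S" "card S \<le> b"
    and I: "finite I" "I \<noteq> {}" "v \<notin> I" and r: "0 < r"
    and max: "\<And>u. u \<in> I \<Longrightarrow> danger b (B \<union> S) c u \<le> danger b (B \<union> S) c v"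
    and old: "set_danger b r B c (insert v I) \<le> Suc (card I) * danger_bound n b r (Suc (card I))"
  shows "set_danger b r (B \<union> S) c I \<le> card I * danger_bound n b r (card I)"
proof (cases "r \<le> card I")
  case True
  then have "(\<Sum>u\<in>insert v I. danger b B c u) \<le> Suc (card I) * danger_bound n b r (Suc (card I))"
    using old I by (simp add: set_danger_def split: if_splits)
  from sum_danger_without_max[OF S I max r True this] True show ?thesis
    by (simp add: set_danger_def)
next
  case False
  have "touching_danger b B c (insert v I) \<le> set_danger b r B c (insert v I)"
    using touching_danger_le_sum_danger[of "insert v I" b B c] I(1) by (simp add: set_danger_def)
  from touching_danger_without_max[OF B S I max _ order.trans[OF this old]] False show ?thesis
    by (simp add: set_danger_def)
qed

lemma set_danger_upd_in_le:
  assumes "finite_graph S" "card S \<le> b" "finite I" "v \<in> I"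
  shows "set_danger b r (B \<union> S) (c(v := Suc (c v))) I \<le> set_danger b r B c I"
proof -
  let ?c = "c(v := Suc (c v))"
  have "touching_danger b (B \<union> S) ?c I = touching_danger b (B \<union> S) c I - 2 * b"
    using assms(3,4) by (simp add: touching_danger_def sum.remove algebra_simps)
  moreover have "(\<Sum>u\<in>I. danger b (B \<union> S) ?c u) = (\<Sum>u\<in>I. danger b (B \<union> S) c u) - 2 * b"
    using assms(3,4) by (simp add: sum.remove danger_def algebra_simps)
  ultimately show ?thesis
    using touching_danger_Un_le[of S b B c I] sum_danger_Un_le[OF assms(1-3), of B c] assms(1,2)
    by (simp add: set_danger_def finite_graph_def)
qed

lemma set_danger_upd_notin:
  assumes "v \<notin> I"
  shows "set_danger b r B (c(v := k)) I = set_danger b r B c I"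
proof -
  have "(\<Sum>u\<in>I. real ((c(v := k)) u)) = (\<Sum>u\<in>I. real (c u))"
    "(\<Sum>u\<in>I. danger b B (c(v := k)) u) = (\<Sum>u\<in>I. danger b B c u)"
    using assms by (auto intro!: sum.cong simp: danger_def)
  then show ?thesis
    by (simp add: set_danger_def touching_danger_def)
qed

lemma danger_controlled_initial:
  fixes r :: real
  assumes "finite V" "r \<le> card V"
  shows "danger_controlled V b r d (\<lambda>_. 0) {}"
  unfolding danger_controlled_def
proof (intro allI impI)
  fix I assume "I \<subseteq> {v \<in> V. 0 < d}" "I \<noteq> {}"
  then have "0 < card I" "card I \<le> card V"
    using assms(1) finite_subset[of I V] card_mono[of V I] by (auto simp: card_gt_0_iff)
  then have "0 \<le> danger_bound (card V) b r (card I)"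
    using assms(2) by (rule danger_bound_nonneg)
  then show "set_danger b r {} (\<lambda>_. 0) I \<le> card I * danger_bound (card V) b r (card I)"
    by (simp add: set_danger_def danger_def touching_danger_def degree_in_def touching_def)
qed

lemma danger_controlled_step:
  assumes controlled: "danger_controlled V b r d c B" and "finite V" "0 < r"
    and B: "finite_graph B" and S: "finite_graph S" "card S \<le> b"
    and v: "v \<in> V" "c v < d"
    and max: "\<And>u. u \<in> V \<Longrightarrow> c u < d \<Longrightarrow> danger b (B \<union> S) c u \<le> danger b (B \<union> S) c v"
  shows "danger_controlled V b r d (c(v := Suc (c v))) (B \<union> S)"
  unfolding danger_controlled_def
proof (intro allI impI)
  let ?c = "c(v := Suc (c v))" and ?G = "danger_bound (card V) b r"
  fix I assume "I \<subseteq> {u \<in> V. ?c u < d}" "I \<noteq> {}"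
  then have I: "I \<subseteq> {u \<in> V. c u < d}" "I \<noteq> {}" "finite I"
    using \<open>finite V\<close> by (auto intro: finite_subset split: if_splits)
  have bound: "set_danger b r B c J \<le> card J * ?G (card J)"
    if "J \<subseteq> {u \<in> V. c u < d}" "J \<noteq> {}" for J
    using controlled that by (simp add: danger_controlled_def)
  show "set_danger b r (B \<union> S) ?c I \<le> card I * ?G (card I)"
  proof (cases "v \<in> I")
    case True
    then show ?thesis
      using order.trans[OF set_danger_upd_in_le[OF S I(3)] bound[OF I(1,2)]] by simp
  next
    case False
    then have "set_danger b r B c (insert v I) \<le> Suc (card I) * ?G (Suc (card I))"
      using bound[of "insert v I"] I v by simp
    from set_danger_without_max[OF B S I(3,2) False \<open>0 < r\<close> max this] I(1) show ?thesis
      by (auto simp: set_danger_upd_notin[OF False])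
  qed
qed

lemma danger_controlled_degree:
  assumes controlled: "danger_controlled V b r d c B" and S: "finite S" "card S \<le> b"
    and v: "v \<in> V" "c v < d"
  shows "degree_in (B \<union> S) v \<le> danger_bound (card V) b r 1 + (2 * d + 1) * b"
proof -
  have "set_danger b r B c {v} = danger b B c v"
    by (simp add: set_danger_def touching_danger_def danger_def touching_singleton)
  then have "danger b B c v \<le> danger_bound (card V) b r 1"
    using controlled v by (auto simp: danger_controlled_def dest!: spec[of _ "{v}"])
  moreover have "degree_in (B \<union> S) v \<le> degree_in B v + b"
    using touching_Un_le[OF S(1), of B "{v}"] S(2) by (simp add: touching_singleton)
  moreover have "real b * real (c v) \<le> real b * real d"
    using v(2) by (intro mult_left_mono) auto
  ultimately show ?thesis
    by (simp add: danger_def algebra_simps)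
qed

section \<open>Derandomised choice of endpoints\<close>

text \<open>
  A set \<open>U\<close> that does not expand is trapped in some \<open>U \<union> W\<close> with \<open>(U, W)\<close> among the following pairs:
  all edges chosen at \<open>U\<close> stay inside \<open>U \<union> W\<close>.
\<close>

definition trap_pairs :: "'a set \<Rightarrow> nat \<Rightarrow> ('a set \<times> 'a set) set" where
  "trap_pairs V k =
     {(U, W). U \<subseteq> V \<and> W \<subseteq> V \<and> 1 \<le> card U \<and> card U \<le> k \<and> card W = 2 * card U}"

text \<open>
  If every vertex of \<open>U\<close> chooses its remaining endpoints, up to \<open>d\<close> in total, at random among at
  least \<open>m\<close> vertices, each choice stays inside \<open>U \<union> W\<close> with probability at most \<open>3 * card U / m\<close>.
\<close>

definition trap_weight :: "real \<Rightarrow> nat \<Rightarrow> ('a \<Rightarrow> 'a set) \<Rightarrow> 'a set \<times> 'a set \<Rightarrow> real" where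
  "trap_weight m d out = (\<lambda>(U, W).
     if \<forall>v\<in>U. out v \<subseteq> U \<union> W then (3 * real (card U) / m) ^ (\<Sum>v\<in>U. d - card (out v)) else 0)"

definition trap_potential :: "'a set \<Rightarrow> nat \<Rightarrow> real \<Rightarrow> nat \<Rightarrow> ('a \<Rightarrow> 'a set) \<Rightarrow> real" where
  "trap_potential V k m d out = (\<Sum>p\<in>trap_pairs V k. trap_weight m d out p)"

lemma finite_trap_pairs: "finite V \<Longrightarrow> finite (trap_pairs V k)"
  by (rule finite_subset[of _ "Pow V \<times> Pow V"]) (auto simp: trap_pairs_def)

lemma trap_weight_nonneg: "0 < m \<Longrightarrow> 0 \<le> trap_weight m d out p"
  by (cases p) (simp add: trap_weight_def)

lemma trap_weight_upd_notin:
  assumes "v \<notin> U"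
  shows "trap_weight m d (out(v := Y)) (U, W) = trap_weight m d out (U, W)"
proof -
  have "(\<Sum>u\<in>U. d - card ((out(v := Y)) u)) = (\<Sum>u\<in>U. d - card (out u))"
    using assms by (intro sum.cong) auto
  moreover have "(\<forall>u\<in>U. (out(v := Y)) u \<subseteq> U \<union> W) \<longleftrightarrow> (\<forall>u\<in>U. out u \<subseteq> U \<union> W)"
    using assms by auto
  ultimately show ?thesis
    unfolding trap_weight_def prod.case by metis
qed

lemma trap_weight_upd_in:
  assumes "finite U" "v \<in> U" "finite (out v)" "card (out v) < d" "x \<notin> out v"
  shows "3 * real (card U) / m * trap_weight m d (out(v := insert x (out v))) (U, W) =
    (if x \<in> U \<union> W then trap_weight m d out (U, W) else 0)"
proof -
  let ?out = "out(v := insert x (out v))"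
  have "(\<Sum>u\<in>U - {v}. d - card (?out u)) = (\<Sum>u\<in>U - {v}. d - card (out u))"
    by (intro sum.cong) auto
  then have "(\<Sum>u\<in>U. d - card (out u)) = Suc (\<Sum>u\<in>U. d - card (?out u))"
    using assms by (simp add: sum.remove)
  moreover have "(\<forall>u\<in>U. ?out u \<subseteq> U \<union> W) \<longleftrightarrow> (\<forall>u\<in>U. out u \<subseteq> U \<union> W) \<and> x \<in> U \<union> W"
    using assms(2) by auto
  ultimately show ?thesis
    unfolding trap_weight_def prod.case by simp
qed

lemma sum_trap_weight_upd_in:
  assumes "finite U" "v \<in> U" "finite (out v)" "card (out v) < d" "finite X" "X \<inter> out v = {}"
  shows "3 * real (card U) / m * (\<Sum>x\<in>X. trap_weight m d (out(v := insert x (out v))) (U, W)) =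
    card (X \<inter> (U \<union> W)) * trap_weight m d out (U, W)"
proof -
  have "3 * real (card U) / m * trap_weight m d (out(v := insert x (out v))) (U, W) =
      (if x \<in> U \<union> W then trap_weight m d out (U, W) else 0)" if "x \<in> X" for x
    using that assms by (intro trap_weight_upd_in) auto
  then have "3 * real (card U) / m * (\<Sum>x\<in>X. trap_weight m d (out(v := insert x (out v))) (U, W)) =
      (\<Sum>x\<in>X. if x \<in> U \<union> W then trap_weight m d out (U, W) else 0)"
    unfolding sum_distrib_left by (rule sum.cong[OF refl])
  also have "\<dots> = card (X \<inter> (U \<union> W)) * trap_weight m d out (U, W)"
    using assms(5) by (subst sum.If_cases) (auto simp: Int_def)
  finally show ?thesis .
qed

lemma trap_weight_average:
  assumes m: "0 < m" "m \<le> real (card X)" and V: "finite V"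
    and v: "card (out v) < d" "finite (out v)" "X \<inter> out v = {}"
    and UW: "(U, W) \<in> trap_pairs V k"
  shows "(\<Sum>x\<in>X. trap_weight m d (out(v := insert x (out v))) (U, W))
    \<le> card X * trap_weight m d out (U, W)"
proof (cases "v \<in> U")
  case False
  then show ?thesis
    by (simp add: trap_weight_upd_notin)
next
  case True
  let ?p = "3 * real (card U) / m" and ?w = "trap_weight m d out (U, W)"
  have fin: "finite U" "finite W" "finite X"
    using UW finite_subset[OF _ V] m card.infinite by (force simp: trap_pairs_def)+
  have U: "0 < card U" "card W = 2 * card U"
    using UW by (auto simp: trap_pairs_def)
  have w: "0 \<le> ?w"
    by (rule trap_weight_nonneg[OF m(1)])
  have "card (X \<inter> (U \<union> W)) \<le> card (U \<union> W)"
    using fin by (intro card_mono) auto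
  also have "\<dots> \<le> 3 * card U"
    using card_Un_le[of U W] U(2) by simp
  finally have few: "card (X \<inter> (U \<union> W)) \<le> 3 * card U" .
  have "?p * (\<Sum>x\<in>X. trap_weight m d (out(v := insert x (out v))) (U, W)) =
      card (X \<inter> (U \<union> W)) * ?w"
    using fin True v by (intro sum_trap_weight_upd_in)
  also have "\<dots> \<le> (3 * card U) * ?w"
    using few w by (intro mult_right_mono of_nat_mono)
  also have "\<dots> = ?p * (m * ?w)"
    using m(1) by simp
  also have "\<dots> \<le> ?p * (card X * ?w)"
    using m w by (intro mult_left_mono mult_right_mono) auto
  finally show ?thesis
    by (rule mult_left_le_imp_le) (use U(1) m(1) in simp)
qed

lemma trap_potential_step:
  assumes m: "0 < m" "m \<le> real (card X)" and V: "finite V"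
    and v: "card (out v) < d" "finite (out v)" "X \<inter> out v = {}"
  shows "\<exists>x\<in>X. trap_potential V k m d (out(v := insert x (out v))) \<le> trap_potential V k m d out"
proof (rule ccontr)
  let ?f = "\<lambda>x. trap_potential V k m d (out(v := insert x (out v)))"
  assume "\<not> ?thesis"
  then have "\<And>x. x \<in> X \<Longrightarrow> trap_potential V k m d out < ?f x"
    by (meson not_le)
  moreover have "finite X" "X \<noteq> {}"
    using m card.infinite by force+
  ultimately have "(\<Sum>x\<in>X. trap_potential V k m d out) < (\<Sum>x\<in>X. ?f x)"
    by (intro sum_strict_mono)
  also have "(\<Sum>x\<in>X. ?f x)
      = (\<Sum>p\<in>trap_pairs V k. \<Sum>x\<in>X. trap_weight m d (out(v := insert x (out v))) p)"
    unfolding trap_potential_def by (rule sum.swap)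
  also have "\<dots> \<le> (\<Sum>p\<in>trap_pairs V k. card X * trap_weight m d out p)"
    using trap_weight_average[where out = out and v = v, OF assms] by (intro sum_mono) auto
  also have "\<dots> = (\<Sum>x\<in>X. trap_potential V k m d out)"
    by (simp add: trap_potential_def sum_distrib_left)
  finally show False
    by simp
qed

lemma expander_of_trap_potential:
  assumes V: "finite V" and potential: "trap_potential V k m d out < 1" and m: "0 < m"
    and out: "\<And>v. v \<in> V \<Longrightarrow> card (out v) = d" "\<And>v. v \<in> V \<Longrightarrow> out v \<subseteq> V"
    and M: "\<And>v x. v \<in> V \<Longrightarrow> x \<in> out v \<Longrightarrow> {v, x} \<in> M" and k: "2 * k \<le> card V"
  shows "expander V k M"
  unfolding expander_def
proof (intro allI impI, rule ccontr)
  fix U assume U: "U \<subseteq> V" "U \<noteq> {}" "card U \<le> k"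
    and "\<not> 2 * card U \<le> card (nbhd V M U)"
  moreover have "nbhd V M U \<subseteq> V"
    by (auto simp: nbhd_def)
  moreover have "2 * card U \<le> card V"
    using U(3) k by simp
  ultimately obtain W where W: "nbhd V M U \<subseteq> W" "W \<subseteq> V" "card W = 2 * card U"
    using exists_subset_between[of "nbhd V M U" "2 * card U" V] V by auto
  have pair: "(U, W) \<in> trap_pairs V k"
    using U W finite_subset[OF U(1) V] by (auto simp: trap_pairs_def Suc_le_eq card_gt_0_iff)
  have "out v \<subseteq> U \<union> W" if "v \<in> U" for v
    using that U(1) out(2)[of v] M[of v] W(1) by (fastforce simp: nbhd_def)
  moreover have "(\<Sum>v\<in>U. d - card (out v)) = 0"
    using U(1) out(1) by (intro sum.neutral) auto
  ultimately have "trap_weight m d out (U, W) = 1"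
    by (simp add: trap_weight_def)
  moreover have "trap_weight m d out (U, W) \<le> trap_potential V k m d out"
    unfolding trap_potential_def using pair trap_weight_nonneg[OF m] finite_trap_pairs[OF V]
    by (intro member_le_sum) auto
  ultimately show False
    using potential by simp
qed

lemma trap_potential_initial:
  assumes "finite V"
  shows "trap_potential V k m d (\<lambda>_. {}) =
    (\<Sum>i=1..k. real (card V choose i) * real (card V choose (2 * i)) * (3 * real i / m) ^ (d * i))"
proof -
  define A where "A i = {U. U \<subseteq> V \<and> card U = i} \<times> {W. W \<subseteq> V \<and> card W = 2 * i}" for i
  have fin: "finite (A i)" for i
    by (rule finite_subset[of _ "Pow V \<times> Pow V"]) (auto simp: A_def assms)
  have "trap_pairs V k = (\<Union>i\<in>{1..k}. A i)"
    by (auto simp: trap_pairs_def A_def)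
  then have "trap_potential V k m d (\<lambda>_. {}) = (\<Sum>i=1..k. \<Sum>p\<in>A i. trap_weight m d (\<lambda>_. {}) p)"
    unfolding trap_potential_def using fin
    by (simp only:, intro sum.UNION_disjoint) (auto simp: A_def)
  also have "\<dots> = (\<Sum>i=1..k. \<Sum>p\<in>A i. (3 * real i / m) ^ (d * i))"
    by (intro sum.cong) (auto simp: A_def trap_weight_def mult.commute)
  also have "\<dots> =
      (\<Sum>i=1..k. real (card V choose i) * real (card V choose (2 * i)) * (3 * real i / m) ^ (d * i))"
    using assms by (intro sum.cong) (auto simp: A_def card_cartesian_product n_subsets)
  finally show ?thesis .
qed

lemma power_self_le_exp_power_fact: "real i ^ i \<le> exp 1 ^ i * fact i"
proof -
  have "(\<Sum>n\<in>{i}. inverse (fact n) * real i ^ n) \<le> (\<Sum>n. inverse (fact n) * real i ^ n)"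
    by (intro sum_le_suminf summable_exp) auto
  also have "\<dots> = exp (real i)"
    by (simp add: exp_def)
  also have "\<dots> = exp 1 ^ i"
    using exp_of_nat_mult[of i "1::real"] by simp
  finally show ?thesis
    by (simp add: field_simps)
qed

lemma binomial_le_exp_power: "real (n choose i) \<le> (exp 1 * real n / real i) ^ i"
proof (cases "i = 0")
  case False
  have "real (n choose i) * real i ^ i \<le> real (n choose i) * (exp 1 ^ i * fact i)"
    using power_self_le_exp_power_fact by (intro mult_left_mono) auto
  also have "\<dots> = exp 1 ^ i * real ((n choose i) * fact i)"
    by simp
  also have "\<dots> \<le> exp 1 ^ i * real (n ^ i)"
    using binomial_fact_pow by (intro mult_left_mono of_nat_mono) auto
  finally show ?thesis
    using False by (simp add: power_divide power_mult_distrib field_simps)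
qed simp

lemma binomial_mult_binomial_double_le:
  assumes "0 < i"
  shows "real (n choose i) * real (n choose (2 * i)) \<le> ((3 * real n / real i) ^ 3) ^ i"
proof -
  let ?q = "3 * real n / real i"
  have "exp 1 * real n / real i \<le> ?q" "exp 1 * real n / real (2 * i) \<le> ?q"
    using exp_le assms by (auto intro!: frac_le mult_right_mono)
  then have "(exp 1 * real n / real i) ^ i \<le> ?q ^ i"
    "(exp 1 * real n / real (2 * i)) ^ (2 * i) \<le> ?q ^ (2 * i)"
    by (intro power_mono; simp)+
  then have "real (n choose i) \<le> ?q ^ i" "real (n choose (2 * i)) \<le> ?q ^ (2 * i)"
    using binomial_le_exp_power order.trans by blast+
  then have "real (n choose i) * real (n choose (2 * i)) \<le> ?q ^ i * ?q ^ (2 * i)"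
    by (intro mult_mono) auto
  also have "\<dots> = (?q ^ 3) ^ i"
    by (simp flip: power_add power_mult)
  finally show ?thesis .
qed

lemma expected_traps_base_le:
  assumes "0 < i" "i \<le> k" "0 < m" "3 \<le> d"
    and small: "4 * 3 ^ (d + 3) * real n ^ 3 * real k ^ (d - 3) \<le> m ^ d"
  shows "(3 * real n / real i) ^ 3 * (3 * real i / m) ^ d \<le> 1 / 4"
proof -
  have "real i ^ d = real i ^ 3 * real i ^ (d - 3)"
    using assms(4) by (simp flip: power_add)
  then have "(3 * real n / real i) ^ 3 * (3 * real i / m) ^ d =
      3 ^ (d + 3) * real n ^ 3 * real i ^ (d - 3) / m ^ d"
    using assms(1) by (simp add: power_divide power_mult_distrib power_add)
  also have "\<dots> \<le> 3 ^ (d + 3) * real n ^ 3 * real k ^ (d - 3) / m ^ d"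
    using assms(2,3) by (intro divide_right_mono mult_left_mono power_mono) auto
  also have "\<dots> \<le> 1 / 4"
    using small assms(3) by (simp add: field_simps)
  finally show ?thesis .
qed

lemma sum_quarter_powers_less: "(\<Sum>i=1..k. (1 / 4 :: real) ^ i) < 1"
proof -
  have "3 * (\<Sum>i=1..k. (1 / 4 :: real) ^ i) = 1 - (1 / 4) ^ k"
    by (induction k) (simp_all add: algebra_simps)
  moreover have "(0 :: real) < (1 / 4) ^ k"
    by (rule zero_less_power) simp
  ultimately show ?thesis
    by linarith
qed

lemma trap_potential_initial_less:
  assumes V: "finite V" and m: "0 < m" and d: "3 \<le> d"
    and small: "4 * 3 ^ (d + 3) * real (card V) ^ 3 * real k ^ (d - 3) \<le> m ^ d"
  shows "trap_potential V k m d (\<lambda>_. {}) < 1"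
proof -
  let ?n = "card V"
  have "real (?n choose i) * real (?n choose (2 * i)) * (3 * real i / m) ^ (d * i) \<le> (1 / 4) ^ i"
    if i: "i \<in> {1..k}" for i
  proof -
    have "real (?n choose i) * real (?n choose (2 * i)) * (3 * real i / m) ^ (d * i)
        \<le> ((3 * real ?n / real i) ^ 3) ^ i * ((3 * real i / m) ^ d) ^ i"
      unfolding power_mult using binomial_mult_binomial_double_le[of i ?n] i m
      by (intro mult_right_mono) auto
    also have "\<dots> = ((3 * real ?n / real i) ^ 3 * (3 * real i / m) ^ d) ^ i"
      by (simp add: power_mult_distrib)
    also have "\<dots> \<le> (1 / 4) ^ i"
      using expected_traps_base_le[of i k m d ?n] i m d small by (intro power_mono) auto
    finally show ?thesis .
  qed
  then have "trap_potential V k m d (\<lambda>_. {}) \<le> (\<Sum>i=1..k. (1 / 4) ^ i)"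
    unfolding trap_potential_initial[OF V] by (rule sum_mono)
  also have "\<dots> < 1"
    by (rule sum_quarter_powers_less)
  finally show ?thesis .
qed

section \<open>Building the expander\<close>

definition chosen_edges :: "'a set \<Rightarrow> ('a \<Rightarrow> 'a set) \<Rightarrow> 'a set set" where
  "chosen_edges V out = {{v, x} | v x. v \<in> V \<and> x \<in> out v}"

definition in_nbrs :: "'a set \<Rightarrow> ('a \<Rightarrow> 'a set) \<Rightarrow> 'a \<Rightarrow> 'a set" where
  "in_nbrs V out x = {u \<in> V. x \<in> out u}"

lemma chosen_edges_upd:
  "v \<in> V \<Longrightarrow> chosen_edges V (out(v := insert x (out v))) = insert {v, x} (chosen_edges V out)"
  by (auto simp: chosen_edges_def split: if_splits)

lemma chosen_edgeD: "{v, x} \<in> chosen_edges V out \<Longrightarrow> x \<in> out v \<or> x \<in> in_nbrs V out v"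
  by (auto simp: chosen_edges_def in_nbrs_def doubleton_eq_iff)

lemma card_in_nbrs_upd_le:
  assumes "finite V"
  shows "card (in_nbrs V (out(v := insert x (out v))) y) \<le>
    card (in_nbrs V out y) + (if y = x then 1 else 0)"
proof -
  have "in_nbrs V (out(v := insert x (out v))) y \<subseteq>
      in_nbrs V out y \<union> (if y = x then {v} else {})"
    by (auto simp: in_nbrs_def split: if_splits)
  moreover have "finite (in_nbrs V out y)"
    using assms by (simp add: in_nbrs_def)
  ultimately have "card (in_nbrs V (out(v := insert x (out v))) y) \<le>
      card (in_nbrs V out y \<union> (if y = x then {v} else {}))"
    by (intro card_mono) auto
  also have "\<dots> \<le> card (in_nbrs V out y) + (if y = x then 1 else 0)"
    by (rule order.trans[OF card_Un_le]) simp
  finally show ?thesis .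
qed

lemma card_large_in_degree_le:
  assumes "finite V" "0 < D" "\<And>v. v \<in> V \<Longrightarrow> out v \<subseteq> V \<and> card (out v) \<le> d"
  shows "card {x \<in> V. D < real (card (in_nbrs V out x))} \<le> d * card V / D"
proof -
  let ?H = "{x \<in> V. D < real (card (in_nbrs V out x))}"
  have "(\<Sum>x\<in>V. card (in_nbrs V out x)) = (\<Sum>v\<in>V. card (out v))"
    unfolding in_nbrs_def
  proof (rule sum_multicount_gen[OF assms(1) assms(1)], rule ballI)
    fix v assume "v \<in> V"
    then have "{x \<in> V. x \<in> out v} = out v"
      using assms(3) by blast
    then show "card {x \<in> V. x \<in> out v} = card (out v)"
      by simp
  qed
  also have "\<dots> \<le> (\<Sum>v\<in>V. d)"
    using assms(3) by (intro sum_mono) blast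
  finally have total: "(\<Sum>x\<in>V. real (card (in_nbrs V out x))) \<le> d * card V"
    using of_nat_mono[of "\<Sum>x\<in>V. card (in_nbrs V out x)" "d * card V", where 'a=real]
    by (simp add: mult.commute)
  have "card ?H * D \<le> (\<Sum>x\<in>?H. real (card (in_nbrs V out x)))"
    using sum_bounded_below[of ?H D "\<lambda>x. real (card (in_nbrs V out x))"] by auto
  also have "\<dots> \<le> (\<Sum>x\<in>V. real (card (in_nbrs V out x)))"
    using assms(1) by (intro sum_mono2) auto
  finally show ?thesis
    using total assms(2) by (simp add: pos_le_divide_eq)
qed

lemma card_nbrs_le_degree:
  assumes "finite B"
  shows "card {x \<in> V. {v, x} \<in> B} \<le> degree_in B v"
  unfolding degree_in_def
proof (rule card_inj_on_le)
  show "inj_on (\<lambda>x. {v, x}) {x \<in> V. {v, x} \<in> B}"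
    by (auto simp: inj_on_def doubleton_eq_iff)
qed (use assms in auto)

locale building_strategy =
  fixes n b d k :: nat and m r D :: real
  assumes n: "3 \<le> n"
    and k: "0 < k" "2 * k \<le> n" "2 * (d + 2) * n * b \<le> k * k"
    and d: "3 \<le> d"
    and r: "0 < r" "r \<le> n"
    and D: "0 < D"
    and m: "0 < m"
    and enough_vertices:
      "m + (d + D + 1) + d * n / D + (danger_bound n b r 1 + (2 * d + 1) * b) \<le> n"
    and few_traps: "4 * 3 ^ (d + 3) * real n ^ 3 * real k ^ (d - 3) \<le> m ^ d"
begin

text \<open>
  \<open>out v\<close> records the endpoints of the edges that Maker chose when playing at \<open>v\<close>. Bounding the
  in-degrees ensures that Maker's own edges do not use up the free edges at a vertex.
\<close>

definition building_state :: "(nat \<Rightarrow> nat set) \<Rightarrow> nat set set \<Rightarrow> bool" where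
  "building_state out B \<longleftrightarrow>
     (\<forall>v<n. out v \<subseteq> {..<n} - {v} \<and> card (out v) \<le> d) \<and>
     B \<subseteq> Kn_edges n \<and> card B \<le> b * (\<Sum>v<n. card (out v)) \<and>
     (\<forall>x<n. real (card (in_nbrs {..<n} out x)) \<le> D + 1) \<and>
     danger_controlled {..<n} b r d (\<lambda>v. card (out v)) B \<and>
     trap_potential {..<n} k m d out < 1"

definition free_endpoints :: "(nat \<Rightarrow> nat set) \<Rightarrow> nat set set \<Rightarrow> nat \<Rightarrow> nat set" where
  "free_endpoints out B v = {x \<in> {..<n} - {v}.
     {v, x} \<notin> chosen_edges {..<n} out \<union> B \<and> real (card (in_nbrs {..<n} out x)) \<le> D}"

definition missing_choices :: "(nat \<Rightarrow> nat set) \<Rightarrow> nat" where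
  "missing_choices out = (\<Sum>v<n. d - card (out v))"

lemma
  assumes "building_state out B"
  shows building_state_out: "v < n \<Longrightarrow> out v \<subseteq> {..<n} - {v} \<and> card (out v) \<le> d"
    and building_state_finite_out: "v < n \<Longrightarrow> finite (out v)"
    and building_state_breaker: "B \<subseteq> Kn_edges n" "card B \<le> b * (\<Sum>v<n. card (out v))"
    and building_state_in_nbrs: "x < n \<Longrightarrow> real (card (in_nbrs {..<n} out x)) \<le> D + 1"
    and building_state_danger: "danger_controlled {..<n} b r d (\<lambda>v. card (out v)) B"
    and building_state_traps: "trap_potential {..<n} k m d out < 1"
  using assms finite_subset[of "out v" "{..<n} - {v}"] by (auto simp: building_state_def)

lemma building_state_initial: "building_state (\<lambda>_. {}) {}"
  using danger_controlled_initial[of "{..<n}" r b d] r(2) D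
    trap_potential_initial_less[of "{..<n}" m d k] m d few_traps
  by (simp add: building_state_def in_nbrs_def)

lemma many_free_endpoints:
  assumes st: "building_state out B" and S: "S \<subseteq> Kn_edges n" "card S \<le> b"
    and v: "v < n" "card (out v) < d"
  shows "m \<le> card (free_endpoints out (B \<union> S) v)"
proof -
  let ?X = "free_endpoints out (B \<union> S) v" and ?In = "in_nbrs {..<n} out v"
  let ?H = "{x \<in> {..<n}. D < real (card (in_nbrs {..<n} out x))}"
  let ?Y = "{x \<in> {..<n}. {v, x} \<in> B \<union> S}"
  have fin: "finite (out v)" "finite ?X" "finite ?In"
    using building_state_finite_out[OF st v(1)] by (auto simp: free_endpoints_def in_nbrs_def)
  have finBS: "finite (B \<union> S)" "finite S"
    using S(1) building_state_breaker(1)[OF st] finite_subset[OF _ finite_Kn_edges] by auto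
  have "{..<n} \<subseteq> ?X \<union> ({v} \<union> (out v \<union> (?In \<union> (?Y \<union> ?H))))"
    using chosen_edgeD[of v _ "{..<n}" out] by (auto simp: free_endpoints_def not_le)
  then have "card {..<n} \<le> card (?X \<union> ({v} \<union> (out v \<union> (?In \<union> (?Y \<union> ?H)))))"
    using fin by (intro card_mono) auto
  also have "\<dots> \<le> card ?X + (card {v} + (card (out v) + (card ?In + (card ?Y + card ?H))))"
    by (intro order.trans[OF card_Un_le] add_left_mono)
      (intro order.trans[OF card_Un_le] add_left_mono order.refl)+
  finally have "n \<le> card ?X + d + card ?In + card ?Y + card ?H"
    using v(2) by simp
  moreover have "card ?In \<le> D + 1"
    using building_state_in_nbrs[OF st v(1)] .
  moreover have "card ?Y \<le> danger_bound n b r 1 + (2 * d + 1) * b"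
    using card_nbrs_le_degree[OF finBS(1), of "{..<n}" v]
      danger_controlled_degree[OF building_state_danger[OF st] finBS(2) S(2), of v] v
    by (simp add: algebra_simps)
  moreover have "card ?H \<le> d * n / D"
    using card_large_in_degree_le[of "{..<n}" D out d] D building_state_out[OF st] by auto
  ultimately show ?thesis
    using enough_vertices by linarith
qed

lemma ex_most_dangerous:
  assumes "0 < missing_choices out"
  shows "\<exists>v<n. card (out v) < d \<and> (\<forall>u<n. card (out u) < d \<longrightarrow>
    danger b B (\<lambda>v. card (out v)) u \<le> danger b B (\<lambda>v. card (out v)) v)"
proof -
  let ?A = "{v \<in> {..<n}. card (out v) < d}" and ?f = "danger b B (\<lambda>v. card (out v))"
  have "?A \<noteq> {}"
  proof
    assume "?A = {}"
    then have "missing_choices out = 0"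
      by (fastforce simp: missing_choices_def)
    with assms show False
      by simp
  qed
  then obtain v where "is_arg_min (\<lambda>u. - ?f u) (\<lambda>u. u \<in> ?A) v"
    using ex_is_arg_min_if_finite[of ?A "\<lambda>u. - ?f u"] by auto
  then show ?thesis
    by (auto simp: is_arg_min_linorder)
qed

lemma building_state_choose:
  assumes st: "building_state out B" and S: "S \<subseteq> Kn_edges n" "card S \<le> b"
    and v: "v < n" "card (out v) < d"
    and most_dangerous: "\<And>u. u < n \<Longrightarrow> card (out u) < d \<Longrightarrow>
      danger b (B \<union> S) (\<lambda>v. card (out v)) u \<le> danger b (B \<union> S) (\<lambda>v. card (out v)) v"
    and x: "x \<in> free_endpoints out (B \<union> S) v" "x \<notin> out v"
    and safe: "trap_potential {..<n} k m d (out(v := insert x (out v)))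
      \<le> trap_potential {..<n} k m d out"
  shows "building_state (out(v := insert x (out v))) (B \<union> S)"
  unfolding building_state_def
proof (intro conjI)
  let ?out = "out(v := insert x (out v))" and ?c = "\<lambda>v. card (out v)"
  have card_out: "(\<lambda>u. card (?out u)) = ?c(v := Suc (?c v))"
    using x(2) building_state_finite_out[OF st v(1)] by auto
  show "\<forall>u<n. ?out u \<subseteq> {..<n} - {u} \<and> card (?out u) \<le> d"
    using building_state_out[OF st] v x fun_cong[OF card_out] by (auto simp: free_endpoints_def)
  show "B \<union> S \<subseteq> Kn_edges n"
    using building_state_breaker(1)[OF st] S(1) by blast
  have "(\<Sum>u<n. card (?out u)) = (\<Sum>u<n. ?c u) + 1"
    unfolding card_out using v(1) by (simp add: sum.remove[of "{..<n}" v])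
  then show "card (B \<union> S) \<le> b * (\<Sum>u<n. card (?out u))"
    using card_Un_le[of B S] S(2) building_state_breaker(2)[OF st] by simp
  show "\<forall>y<n. real (card (in_nbrs {..<n} ?out y)) \<le> D + 1"
  proof (intro allI impI)
    fix y assume "y < n"
    then show "real (card (in_nbrs {..<n} ?out y)) \<le> D + 1"
      using card_in_nbrs_upd_le[of "{..<n}" out v x y] building_state_in_nbrs[OF st, of y] x(1)
      by (auto simp: free_endpoints_def split: if_splits)
  qed
  show "danger_controlled {..<n} b r d (\<lambda>u. card (?out u)) (B \<union> S)"
    unfolding card_out
  proof (rule danger_controlled_step[OF building_state_danger[OF st] _ r(1)])
    show "finite_graph B" "finite_graph S"
      using building_state_breaker(1)[OF st] S(1) by (auto intro: finite_graph_Kn_edges)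
  qed (use S(2) v most_dangerous in auto)
  show "trap_potential {..<n} k m d ?out < 1"
    using safe building_state_traps[OF st] by simp
qed

lemma missing_choices_upd:
  assumes "v < n" "card (out v) < d" "finite (out v)" "x \<notin> out v"
  shows "missing_choices out = Suc (missing_choices (out(v := insert x (out v))))"
proof -
  let ?out = "out(v := insert x (out v))"
  have "(\<Sum>u\<in>{..<n} - {v}. d - card (?out u)) = (\<Sum>u\<in>{..<n} - {v}. d - card (out u))"
    by (intro sum.cong) auto
  then show ?thesis
    using assms by (simp add: missing_choices_def sum.remove[of "{..<n}" v])
qed

lemma building_state_step:
  assumes st: "building_state out B" and missing: "0 < missing_choices out"
    and S: "S \<subseteq> Kn_edges n" "card S \<le> b"
  shows "\<exists>v x. {v, x} \<in> free_edges n (chosen_edges {..<n} out) (B \<union> S) \<and> v < n \<and>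
    building_state (out(v := insert x (out v))) (B \<union> S) \<and>
    missing_choices out = Suc (missing_choices (out(v := insert x (out v))))"
proof -
  obtain v where v: "v < n" "card (out v) < d" and most_dangerous: "\<And>u. u < n \<Longrightarrow> card (out u) < d \<Longrightarrow>
      danger b (B \<union> S) (\<lambda>v. card (out v)) u \<le> danger b (B \<union> S) (\<lambda>v. card (out v)) v"
    using ex_most_dangerous[OF missing] by blast
  let ?X = "free_endpoints out (B \<union> S) v"
  have fin: "finite (out v)"
    using st v(1) by (rule building_state_finite_out)
  have "?X \<inter> out v = {}"
    using v(1) by (auto simp: free_endpoints_def chosen_edges_def)
  then obtain x where x: "x \<in> ?X" "x \<notin> out v"
    and "trap_potential {..<n} k m d (out(v := insert x (out v))) \<le> trap_potential {..<n} k m d out"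
    using trap_potential_step[OF m many_free_endpoints[OF st S v], of "{..<n}" out v d k] v(2) fin
    by auto
  then have "building_state (out(v := insert x (out v))) (B \<union> S)"
    using st S v most_dangerous by (intro building_state_choose)
  moreover have "{v, x} \<in> free_edges n (chosen_edges {..<n} out) (B \<union> S)"
    using x(1) v(1) by (auto simp: free_endpoints_def free_edges_def intro!: Kn_edgesI)
  ultimately show ?thesis
    using v(1) missing_choices_upd[where out = out, OF v fin x(2)] by blast
qed

lemma maker_wins_from_complete_state:
  assumes st: "building_state out B" and complete: "missing_choices out = 0"
  shows "maker_wins_within n b (2 * n) (chosen_edges {..<n} out) B"
proof (rule maker_wins_from_expander[OF n k(1)])
  have card_out: "card (out v) = d" if "v < n" for v
    using complete building_state_out[OF st that] that by (force simp: missing_choices_def)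
  show "expander {..<n} k (chosen_edges {..<n} out)"
  proof (rule expander_of_trap_potential[OF _ building_state_traps[OF st] m])
    show "out v \<subseteq> {..<n}" if "v \<in> {..<n}" for v
      using building_state_out[OF st, of v] that by auto
  qed (use card_out k(2) in \<open>auto simp: chosen_edges_def\<close>)
  show "B \<subseteq> Kn_edges n"
    using st by (rule building_state_breaker)
  have "card B \<le> b * (n * d)"
    using building_state_breaker(2)[OF st] card_out by simp
  then have "2 * (card B + b * (2 * n)) \<le> 2 * (d + 2) * n * b"
    by (simp add: algebra_simps)
  then show "2 * (card B + b * (2 * n)) \<le> k * k"
    using k(3) by (rule order.trans)
qed

lemma maker_wins_from_building_state:
  "building_state out B \<Longrightarrow>
    maker_wins_within n b (2 * n + missing_choices out) (chosen_edges {..<n} out) B"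
proof (induction "missing_choices out" arbitrary: out B)
  case 0
  then show ?case
    using maker_wins_from_complete_state by simp
next
  case (Suc j)
  have "\<exists>e \<in> free_edges n (chosen_edges {..<n} out) (B \<union> S).
      maker_wins_within n b (2 * n + j) (insert e (chosen_edges {..<n} out)) (B \<union> S)"
    if S: "S \<in> breaker_moves n b (chosen_edges {..<n} out) B" for S
  proof -
    obtain v x where e: "{v, x} \<in> free_edges n (chosen_edges {..<n} out) (B \<union> S)" "v < n"
      and st: "building_state (out(v := insert x (out v))) (B \<union> S)"
      and missing: "missing_choices out = Suc (missing_choices (out(v := insert x (out v))))"
      using building_state_step[OF Suc.prems _ breaker_movesD[OF S]] Suc.hyps(2) by auto
    have j: "j = missing_choices (out(v := insert x (out v)))"
      using missing Suc.hyps(2) by simp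
    from Suc.hyps(1)[OF j st] e show ?thesis
      unfolding j[symmetric] by (auto simp: chosen_edges_upd)
  qed
  then show ?case
    unfolding Suc.hyps(2)[symmetric] by simp
qed

lemma maker_wins: "maker_wins_within n b ((d + 2) * n) {} {}"
proof -
  have "2 * n + missing_choices (\<lambda>_. {}) = (d + 2) * n"
    by (simp add: missing_choices_def algebra_simps)
  moreover have "chosen_edges {..<n} (\<lambda>_. {}) = {}"
    by (simp add: chosen_edges_def)
  ultimately show ?thesis
    using maker_wins_from_building_state[OF building_state_initial] by metis
qed

end

section \<open>Choice of parameters\<close>

definition expansion_size :: "nat \<Rightarrow> nat" where
  "expansion_size n = nat \<lfloor>7 * real n / sqrt (ln (real n))\<rfloor>"

lemma eventually_expansion_size_bounds:
  "\<forall>\<^sub>F n in sequentially. 1 \<le> 6 * real n / sqrt (ln (real n)) \<and>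
     6 * real n / sqrt (ln (real n)) \<le> real (expansion_size n) \<and>
     real (expansion_size n) \<le> 7 * real n / sqrt (ln (real n))"
proof -
  have "\<forall>\<^sub>F n in sequentially. 1 \<le> 6 * real n / sqrt (ln (real n))"
    "\<forall>\<^sub>F n in sequentially. 6 * real n / sqrt (ln (real n)) + 1 \<le> 7 * real n / sqrt (ln (real n))"
    by real_asymp+
  then show ?thesis
    by eventually_elim (unfold expansion_size_def, linarith)
qed

lemma eventually_few_traps:
  "\<forall>\<^sub>F n in sequentially. 4 * 3 ^ 15 * real n ^ 3 * real (expansion_size n) ^ 9
     \<le> (real n / ln (real n) powr (1/4)) ^ 12"
proof -
  have "\<forall>\<^sub>F n in sequentially. 4 * 3 ^ 15 * real n ^ 3 * (7 * real n / sqrt (ln (real n))) ^ 9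
      \<le> (real n / ln (real n) powr (1/4)) ^ 12"
    by real_asymp
  with eventually_expansion_size_bounds show ?thesis
  proof eventually_elim
    case (elim n)
    then have "4 * 3 ^ 15 * real n ^ 3 * real (expansion_size n) ^ 9
        \<le> 4 * 3 ^ 15 * real n ^ 3 * (7 * real n / sqrt (ln (real n))) ^ 9"
      by (intro mult_left_mono power_mono) auto
    with elim show ?case
      by linarith
  qed
qed

lemma breaker_edges_le_square:
  assumes "6 * real n / sqrt (ln (real n)) \<le> real k" "1 < ln (real n)"
    and "real b \<le> real n / ln (real n)"
  shows "28 * n * b \<le> k * k"
proof -
  have "28 * real n * real b \<le> 36 * real n * (real n / ln (real n))"
    using assms(3) by (intro mult_mono) auto
  also have "\<dots> = (6 * real n / sqrt (ln (real n))) * (6 * real n / sqrt (ln (real n)))"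
    using assms(2) by (simp add: field_simps)
  also have "\<dots> \<le> real k * real k"
    using assms(1,2) by (intro mult_mono) auto
  finally have "real (28 * n * b) \<le> real (k * k)"
    by simp
  then show ?thesis
    by (simp only: of_nat_le_iff)
qed

lemma danger_bound_singleton:
  assumes "1 < ln (real n)"
  shows "danger_bound n b (real n / ln (real n)) 1 =
    b * (ln (real n) + ln (ln (real n))) + real n / ln (real n)"
proof -
  have "0 < n"
    using assms by (cases n) auto
  then have "ln (real n) \<le> real n"
    using ln_le_minus_one[of "real n"] by simp
  then have "1 \<le> real n / ln (real n)"
    using assms by simp
  then have "danger_bound n b (real n / ln (real n)) 1 =
      b * ln (real n) + b * (ln (real n) - ln (real n / ln (real n))) + real n / ln (real n)"
    by (simp add: danger_bound_def max_absorb1)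
  also have "ln (real n / ln (real n)) = ln (real n) - ln (ln (real n))"
    using assms \<open>0 < n\<close> by (simp add: ln_div)
  finally show ?thesis
    by (simp add: algebra_simps)
qed

text \<open>
  The main terms are \<open>b * ln n\<close> of \<open>danger_bound\<close>, at most \<open>n - 30 * n / ln n powr (1/4)\<close>, and the
  reserve of \<open>n / ln n powr (1/4)\<close> free endpoints.
\<close>

lemma eventually_enough_vertices:
  "\<forall>\<^sub>F n in sequentially. \<forall>b::nat.
     real b \<le> (1 - 30 / ln (real n) powr (1/4)) * real n / ln (real n) \<longrightarrow>
     real n / ln (real n) powr (1/4) + (12 + ln (real n) + 1) + 12 * n / ln (real n) +
       (danger_bound n b (real n / ln (real n)) 1 + (2 * 12 + 1) * b) \<le> n"
proof -
  have "\<forall>\<^sub>F n in sequentially. 1 < ln (real n)"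
    "\<forall>\<^sub>F n in sequentially.
      real n / ln (real n) powr (1/4) + (12 + ln (real n) + 1) + 12 * real n / ln (real n) +
        ((1 - 30 / ln (real n) powr (1/4)) * real n / ln (real n) *
          (ln (real n) + ln (ln (real n)) + 25) + real n / ln (real n)) \<le> real n"
    by real_asymp+
  then show ?thesis
  proof eventually_elim
    case (elim n)
    let ?L = "ln (real n)"
    show ?case
    proof (intro allI impI)
      fix b :: nat
      assume "real b \<le> (1 - 30 / ?L powr (1/4)) * real n / ?L"
      then have "real b * (?L + ln ?L + 25) \<le>
          (1 - 30 / ?L powr (1/4)) * real n / ?L * (?L + ln ?L + 25)"
        using elim(1) by (intro mult_right_mono) auto
      moreover have "danger_bound n b (real n / ?L) 1 + (2 * 12 + 1) * b =
          real b * (?L + ln ?L + 25) + real n / ?L"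
        unfolding danger_bound_singleton[OF elim(1)] by (simp add: algebra_simps)
      ultimately show "real n / ?L powr (1/4) + (12 + ?L + 1) + 12 * n / ?L +
          (danger_bound n b (real n / ?L) 1 + (2 * 12 + 1) * b) \<le> n"
        using elim(2) by simp
    qed
  qed
qed

lemma eventually_building_strategy:
  "\<forall>\<^sub>F n in sequentially. \<forall>b::nat.
     real b \<le> (1 - 30 / ln (real n) powr (1/4)) * real n / ln (real n) \<longrightarrow>
     building_strategy n b 12 (expansion_size n)
       (real n / ln (real n) powr (1/4)) (real n / ln (real n)) (ln (real n))"
proof -
  have "\<forall>\<^sub>F n in sequentially. 1 < ln (real n)"
    "\<forall>\<^sub>F n in sequentially. 2 * (7 * real n / sqrt (ln (real n))) \<le> real n"
    by real_asymp+
  with eventually_expansion_size_bounds eventually_few_traps eventually_enough_vertices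
    eventually_ge_at_top[of "3 :: nat"]
  show ?thesis
  proof eventually_elim
    case (elim n)
    show ?case
    proof (intro allI impI)
      fix b :: nat
      assume b: "real b \<le> (1 - 30 / ln (real n) powr (1/4)) * real n / ln (real n)"
      also have "\<dots> \<le> 1 * real n / ln (real n)"
        using elim by (intro divide_right_mono mult_right_mono) auto
      finally have few_breaker_edges: "28 * n * b \<le> expansion_size n * expansion_size n"
        using elim by (intro breaker_edges_le_square) auto
      have "1 \<le> real (expansion_size n)" "2 * real (expansion_size n) \<le> real n"
        using elim by linarith+
      then have size: "0 < expansion_size n" "2 * expansion_size n \<le> n"
        by linarith+
      have "real n / ln (real n) \<le> real n"
        using elim by (simp add: divide_le_eq)
      with elim b few_breaker_edges size show "building_strategy n b 12 (expansion_size n)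
          (real n / ln (real n) powr (1/4)) (real n / ln (real n)) (ln (real n))"
        by unfold_locales (simp_all del: times_divide_eq_left)
    qed
  qed
qed

theorem theorem1:
  shows "\<exists>n0::nat. \<forall>n\<ge>n0. \<forall>b::nat. 0 < b \<and>
           real b \<le> (1 - 30 / (ln (real n)) powr (1/4)) * real n / ln (real n) \<longrightarrow>
           maker_wins_within n b (14 * n) {} {}"
proof -
  obtain n0 where "building_strategy n b 12 (expansion_size n)
      (real n / ln (real n) powr (1/4)) (real n / ln (real n)) (ln (real n))"
    if "n0 \<le> n" "real b \<le> (1 - 30 / ln (real n) powr (1/4)) * real n / ln (real n)" for n b
    using eventually_building_strategy unfolding eventually_sequentially by blast
  then have "maker_wins_within n b (14 * n) {} {}"
    if "n0 \<le> n" "real b \<le> (1 - 30 / ln (real n) powr (1/4)) * real n / ln (real n)" for n b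
    using building_strategy.maker_wins that by fastforce
  then show ?thesis
    by blast
qed

end
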